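(* Let $\nu>0$ and $z\in\mathbb{C}\setminus(-\infty,0]$. Then $$\int_0^\infty J_\nu(cz)\,J_{2\nu}\left(2\sqrt{c}\right)dc=\frac1z\,J_\nu\left(\frac1z\right).$$
   Context: $J_\nu:\mathbb{C}\setminus(-\infty,0]\to\mathbb{C}$ is the Bessel function of the first kind of order $\nu$.
   Formalization: For nonreal z the integral diverges, since J_ν(cz) grows like exp(c|Im z|); there the left side is read as the analytic continuation in z of the convergent improper integral over z>0. For z>0 the formula is proved literally. *)

theory Defs
  imports "HOL-Complex_Analysis.Complex_Analysis"
begin

text \<open>
  \<^const>\<open>powr\<close> is taken with the principal branch, so this is the Bessel function of the first kind
  on the plane cut along the nonpositive real axis; its values on the cut itself are junk.
\<close>
definition bessel_J :: "real \<Rightarrow> complex \<Rightarrow> complex" where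
  "bessel_J \<nu> z = (z / 2) powr complex_of_real \<nu> *
     (\<Sum>k. (-1) ^ k / fact k * rGamma (complex_of_real \<nu> + of_nat k + 1) * (z / 2) ^ (2 * k))"

text \<open>
  The integral of \<open>f z\<close> over the half-line, as a function of \<open>z\<close> in the cut plane, has the value \<open>I\<close>
  at \<open>z\<close>.  For \<open>z > 0\<close> it is the improper integral (on an unbounded interval, \<^const>\<open>has_integral\<close>
  allows conditional convergence).  For nonreal \<open>z\<close> an integrand such as \<open>bessel_J \<nu> (c * z) * g c\<close>
  grows like \<open>exp (c * \<bar>Im z\<bar>)\<close> unless \<open>g\<close> decays exponentially; the integral then diverges and
  can only be understood by analytic continuation in \<open>z\<close> from the positive axis.
\<close>
definition has_continued_integral ::
    "(complex \<Rightarrow> real \<Rightarrow> complex) \<Rightarrow> complex \<Rightarrow> complex \<Rightarrow> bool" where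
  "has_continued_integral f I z \<longleftrightarrow>
     (\<exists>F. F holomorphic_on - \<real>\<^sub>\<le>\<^sub>0 \<and>
          (\<forall>x>0. (f (complex_of_real x) has_integral F (complex_of_real x)) {0..}) \<and>
          F z = I)"

lemma has_continued_integral_pos_real:
  assumes "has_continued_integral f I (complex_of_real x)" "x > 0"
  shows   "(f (complex_of_real x) has_integral I) {0..}"
  using assms unfolding has_continued_integral_def by blast

lemma connected_cut_plane: "connected (- \<real>\<^sub>\<le>\<^sub>0 :: complex set)"
proof -
  have "(\<real>\<^sub>\<le>\<^sub>0 :: complex set) = complex_of_real ` {..0}"
    by (auto simp: nonpos_Reals_def)
  then show ?thesis
    by (metis simply_connected_slotted_complex_plane_left simply_connected_imp_connected)
qed

lemma has_continued_integral_unique: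
  assumes "has_continued_integral f I z" "has_continued_integral f J z" "z \<notin> \<real>\<^sub>\<le>\<^sub>0"
  shows   "I = J"
proof -
  obtain F where F: "F holomorphic_on - \<real>\<^sub>\<le>\<^sub>0" "F z = I"
      "\<And>x. x > 0 \<Longrightarrow> (f (complex_of_real x) has_integral F (complex_of_real x)) {0..}"
    using assms(1) unfolding has_continued_integral_def by blast
  obtain G where G: "G holomorphic_on - \<real>\<^sub>\<le>\<^sub>0" "G z = J"
      "\<And>x. x > 0 \<Longrightarrow> (f (complex_of_real x) has_integral G (complex_of_real x)) {0..}"
    using assms(2) unfolding has_continued_integral_def by blast
  have lim: "(1::complex) islimpt (complex_of_real ` {0<..})"
  proof (unfold islimpt_approachable, intro allI impI)
    fix e :: real assume "e > 0"
    define w where "w = complex_of_real (1 + e / 2)"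
    have "w \<in> complex_of_real ` {0<..}"
      unfolding w_def using \<open>e > 0\<close> by (intro imageI) simp
    moreover have "dist w 1 = e / 2"
      using \<open>e > 0\<close> by (simp add: w_def dist_norm norm_divide)
    ultimately show "\<exists>w\<in>complex_of_real ` {0<..}. w \<noteq> 1 \<and> dist w 1 < e"
      using \<open>e > 0\<close> by (intro bexI[of _ w]) auto
  qed
  have "F z - G z = 0"
  proof (rule analytic_continuation[where f = "\<lambda>w. F w - G w" and S = "- \<real>\<^sub>\<le>\<^sub>0"
            and U = "complex_of_real ` {0<..}" and \<xi> = 1])
    show "(\<lambda>w. F w - G w) holomorphic_on - \<real>\<^sub>\<le>\<^sub>0"
      using F(1) G(1) by (intro holomorphic_intros)
    show "open (- \<real>\<^sub>\<le>\<^sub>0 :: complex set)" by auto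
    show "complex_of_real ` {0<..} \<subseteq> - \<real>\<^sub>\<le>\<^sub>0" by auto
    show "(1::complex) \<in> - \<real>\<^sub>\<le>\<^sub>0" by simp
    show "F w - G w = 0" if "w \<in> complex_of_real ` {0<..}" for w
    proof -
      from that obtain x where x: "x > 0" "w = complex_of_real x" by auto
      show ?thesis
        using has_integral_unique[OF F(3)[OF x(1)] G(3)[OF x(1)]] x(2) by simp
    qed
    show "z \<in> - \<real>\<^sub>\<le>\<^sub>0" using assms(3) by simp
  qed (fact connected_cut_plane lim)+
  then show ?thesis using F(2) G(2) by simp
qed

end

theory Submission
  imports Defs
begin

text \<open>
  By the definition of the continued integral, only \<open>z = x > 0\<close> needs work.  With a damping factor
  \<open>exp (- p * c)\<close> the series of \<open>J\<^bsub>2\<nu>\<^esub> (2 * sqrt c)\<close> may be integrated termwise, which expresses the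
  integral through the derivatives \<open>L\<^bsup>(k)\<^esup> p\<close> of the Laplace transform
  \<open>L p = const * (p\<^sup>2 + x\<^sup>2) powr (- \<nu> - 1/2)\<close> of \<open>c powr \<nu> * J\<^sub>\<nu> (c * x)\<close>, with weights
  \<open>1 / (k! * Gamma (2 * \<nu> + k + 1))\<close>.  Since \<open>L\<close> is holomorphic near \<open>0\<close>, the Cauchy inequalities allow
  \<open>p \<rightarrow> 0\<close> in the sum, and the binomial series of \<open>L\<close> together with the duplication formula turns the
  limit into the series of \<open>J\<^sub>\<nu> (1 / x) / x\<close>.

  The undamped integral converges only conditionally.  As \<open>J\<^bsub>\<nu>+1\<^esub> (c * x) * J\<^bsub>2\<nu>\<^esub> (2 * sqrt c) / x\<close> is a
  primitive of the integrand up to a remainder of order \<open>c powr (- 5/4)\<close>, one integration by parts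
  gives both its convergence and its agreement with the limit of the damped integrals.
\<close>

subsection \<open>The Bessel-Clifford function and its decay\<close>

text \<open>Splitting off the multivalued power leaves an entire function: \<open>J\<^sub>\<mu> y =
  (y / 2) powr \<mu> * bessel_clifford \<mu> ((y / 2)^2)\<close>. In particular \<open>J\<close> of
  order \<open>2 * \<nu>\<close> at \<open>2 * sqrt c\<close> is
  \<open>c powr \<nu> * bessel_clifford (2 * \<nu>) c\<close>, without any square root.\<close>

definition bessel_clifford :: "real \<Rightarrow> real \<Rightarrow> real" where
  "bessel_clifford \<mu> w = (\<Sum>k. (-1) ^ k / fact k * rGamma (\<mu> + of_nat k + 1) * w ^ k)"

text \<open>The functional equation divides by \<open>\<mu> + k + 1 \<ge> k + 1\<close> at each
  step. The factor \<open>1 / fact k\<close> gained this way feeds the majorants of the termwise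
  integrations and of the limit \<open>p \<rightarrow> 0\<close>.\<close>

lemma rGamma_shift_le:
  fixes \<mu> :: real
  assumes "\<mu> \<ge> 0"
  shows "0 < rGamma (\<mu> + of_nat k + 1)" "rGamma (\<mu> + of_nat k + 1) \<le> rGamma (\<mu> + 1) / fact k"
proof -
  show pos: "0 < rGamma (\<mu> + of_nat k + 1)" for k
    using assms Gamma_real_pos[of "\<mu> + of_nat k + 1"] by (simp add: rGamma_inverse_Gamma)
  show "rGamma (\<mu> + of_nat k + 1) \<le> rGamma (\<mu> + 1) / fact k"
  proof (induction k)
    case (Suc k)
    have "rGamma (\<mu> + of_nat k + 1) = (\<mu> + of_nat k + 1) * rGamma (\<mu> + of_nat k + 1 + 1)"
      by (rule rGamma_plus1 [symmetric])
    also have "\<dots> \<ge> (of_nat k + 1) * rGamma (\<mu> + of_nat k + 1 + 1)"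
      using assms pos[of "Suc k"] by (intro mult_right_mono) (auto simp: algebra_simps)
    finally have "(of_nat k + 1) * rGamma (\<mu> + of_nat (Suc k) + 1) \<le> rGamma (\<mu> + 1) / fact k"
      using Suc.IH by (simp add: algebra_simps)
    then have "rGamma (\<mu> + of_nat (Suc k) + 1) \<le> rGamma (\<mu> + 1) / fact k / (of_nat k + 1)"
      by (subst pos_le_divide_eq) (auto simp: mult_ac)
    then show ?case
      by (simp add: mult_ac add_ac)
  qed simp
qed

text \<open>Stated over a general field: the real instance serves \<open>bessel_clifford\<close>,
  the complex one the holomorphy of \<open>bessel_J\<close>.\<close>

lemma summable_bessel_clifford:
  fixes w :: "'a :: {real_normed_field, banach}"
  assumes "\<mu> \<ge> 0"
  shows "summable (\<lambda>k. of_real ((-1) ^ k / fact k * rGamma (\<mu> + of_nat k + 1)) * w ^ k)"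
proof (rule summable_comparison_test)
  have "rGamma (\<mu> + of_nat k + 1) \<le> rGamma (\<mu> + 1)" for k
  proof -
    have "rGamma (\<mu> + 1) / fact k \<le> rGamma (\<mu> + 1) / 1"
      using rGamma_shift_le(1)[OF assms, of 0] by (intro divide_left_mono) auto
    then show ?thesis
      using rGamma_shift_le(2)[OF assms, of k] by simp
  qed
  then have "rGamma (\<mu> + of_nat n + 1) * (inverse (fact n) * norm w ^ n)
      \<le> rGamma (\<mu> + 1) * (inverse (fact n) * norm w ^ n)" for n
    by (intro mult_right_mono) auto
  moreover have "norm (of_real ((-1) ^ n / fact n * rGamma (\<mu> + of_nat n + 1)) * w ^ n :: 'a)
    = rGamma (\<mu> + of_nat n + 1) * (inverse (fact n) * norm w ^ n)" for n
    using rGamma_shift_le(1)[OF assms, of n]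
    by (simp only: norm_mult norm_power norm_of_real abs_mult abs_divide) (simp add: divide_simps)
  ultimately show "\<exists>N. \<forall>n\<ge>N. norm (of_real ((-1) ^ n / fact n * rGamma (\<mu> + of_nat n + 1)) * w ^ n :: 'a)
    \<le> rGamma (\<mu> + 1) * (inverse (fact n) * norm w ^ n)"
    by simp
  show "summable (\<lambda>n. rGamma (\<mu> + 1) * (inverse (fact n) * norm w ^ n))"
    by (intro summable_mult summable_exp)
qed

lemma bessel_clifford_sums:
  assumes "\<mu> \<ge> 0"
  shows "(\<lambda>k. (-1) ^ k / fact k * rGamma (\<mu> + of_nat k + 1) * w ^ k) sums bessel_clifford \<mu> w"
  using summable_bessel_clifford[OF assms, of w] by (simp add: bessel_clifford_def summable_sums)

lemma has_real_derivative_bessel_clifford [derivative_intros]: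
  assumes "\<mu> \<ge> 0" "(g has_real_derivative d) (at x within S)"
  shows "((\<lambda>x. bessel_clifford \<mu> (g x)) has_real_derivative
           - bessel_clifford (\<mu> + 1) (g x) * d) (at x within S)"
proof -
  let ?c = "\<lambda>k. (-1) ^ k / fact k * rGamma (\<mu> + of_nat k + 1)"
  have "diffs ?c n = - ((-1) ^ n / fact n * rGamma (\<mu> + 1 + of_nat n + 1))" for n
    by (simp add: diffs_def divide_simps add_ac)
  then have "(\<Sum>n. diffs ?c n * w ^ n) = - bessel_clifford (\<mu> + 1) w" for w
    using suminf_minus[OF sums_summable[OF bessel_clifford_sums[of "\<mu> + 1" w]]] assms(1)
    by (simp add: bessel_clifford_def)
  moreover have "DERIV (\<lambda>w. \<Sum>n. ?c n * w ^ n) w :> (\<Sum>n. diffs ?c n * w ^ n)" for w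
    using summable_bessel_clifford[OF assms(1), where ?'a = real]
    by (intro termdiffs_strong_converges_everywhere) simp
  ultimately have "(bessel_clifford \<mu> has_real_derivative - bessel_clifford (\<mu> + 1) w) (at w)" for w
    by (simp add: bessel_clifford_def[abs_def])
  from DERIV_chain2[OF this assms(2)] show ?thesis .
qed

lemma continuous_on_bessel_clifford [continuous_intros]:
  assumes "\<mu> \<ge> 0" "continuous_on S g"
  shows "continuous_on S (\<lambda>x. bessel_clifford \<mu> (g x))"
proof -
  have "continuous_on UNIV (bessel_clifford \<mu>)"
    using has_real_derivative_bessel_clifford[OF assms(1) DERIV_ident]
    by (intro continuous_at_imp_continuous_on) (blast intro: DERIV_isCont)
  from continuous_on_compose2[OF this assms(2)] show ?thesis by simp
qed

text \<open>In each coefficient the functional equation of \<open>rGamma\<close> produces a factor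
  \<open>(\<mu> + 1) + k\<close>. The part \<open>\<mu> + 1\<close> gives the first series; the part
  \<open>k\<close> cancels against \<open>fact k\<close> and shifts the index by one, which gives
  the second.\<close>

lemma bessel_clifford_recurrence:
  assumes "\<mu> \<ge> 0"
  shows "bessel_clifford \<mu> w =
           (\<mu> + 1) * bessel_clifford (\<mu> + 1) w - w * bessel_clifford (\<mu> + 2) w"
proof -
  let ?t = "\<lambda>\<mu> k. (-1) ^ k / fact k * rGamma (\<mu> + of_nat k + 1) * w ^ k"
  have s: "?t \<mu> sums bessel_clifford \<mu> w" if "\<mu> \<ge> 0" for \<mu>
    using bessel_clifford_sums[OF that] by simp
  have "(\<lambda>k. if k = 0 then 0 else - w * ?t (\<mu> + 2) (k - 1)) sums (- w * bessel_clifford (\<mu> + 2) w)"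
    using sums_Suc[of "\<lambda>k. if k = 0 then 0 else - w * ?t (\<mu> + 2) (k - 1)"
        "- w * bessel_clifford (\<mu> + 2) w"] sums_mult[OF s[of "\<mu> + 2"], of "- w"] assms
    by simp
  from sums_add[OF sums_mult[OF s[of "\<mu> + 1"], of "\<mu> + 1"] this]
  have "(\<lambda>k. (\<mu> + 1) * ?t (\<mu> + 1) k + (if k = 0 then 0 else - w * ?t (\<mu> + 2) (k - 1))) sums
    ((\<mu> + 1) * bessel_clifford (\<mu> + 1) w + - w * bessel_clifford (\<mu> + 2) w)"
    using assms by simp
  moreover have "(\<mu> + 1) * ?t (\<mu> + 1) k + (if k = 0 then 0 else - w * ?t (\<mu> + 2) (k - 1)) = ?t \<mu> k" for k
  proof (cases k)
    case 0
    then show ?thesis using rGamma_plus1[of "\<mu> + 1"] by (simp add: algebra_simps)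
  next
    case (Suc j)
    have "rGamma (\<mu> + of_nat k + 1) = (\<mu> + of_nat j + 2) * rGamma (\<mu> + of_nat j + 3)"
      using rGamma_plus1[of "\<mu> + of_nat j + 2"] Suc by (simp add: algebra_simps)
    moreover have "1 + real j \<noteq> 0" by linarith
    ultimately show ?thesis using Suc by (simp add: divide_simps) (simp add: algebra_simps)
  qed
  ultimately show ?thesis
    using s[OF assms] sums_unique2 by fastforce
qed

section \<open>Decay from the Bessel differential equation\<close>

lemma oscillator_bounded:
  fixes u v :: "real \<Rightarrow> real"
  assumes u: "\<And>y. y > 0 \<Longrightarrow> (u has_real_derivative v y) (at y)"
    and v: "\<And>y. y > 0 \<Longrightarrow> (v has_real_derivative (a / y\<^sup>2 - 1) * u y) (at y)"
    and "y \<ge> 1"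
  shows "(u y)\<^sup>2 \<le> ((u 1)\<^sup>2 + (v 1)\<^sup>2) * exp \<bar>a\<bar>"
proof -
  \<comment> \<open>The energy \<open>u^2 + v^2\<close> has derivative
    \<open>2 * u * v * a / y^2\<close>, at most \<open>\<bar>a\<bar> / y^2\<close> times the energy
    itself. The weight falls fast enough to make the product nonincreasing; it is at least 1
    throughout and equals \<open>exp \<bar>a\<bar>\<close> at 1.\<close>
  define E where "E = (\<lambda>y. ((u y)\<^sup>2 + (v y)\<^sup>2) * exp (\<bar>a\<bar> / y))"
  have "E y \<le> E 1"
  proof (rule DERIV_nonpos_imp_nonincreasing[OF \<open>y \<ge> 1\<close>])
    fix t assume t: "1 \<le> t" "t \<le> y"
    define d where "d = (2 * u t * v t * (a / t\<^sup>2) - \<bar>a\<bar> / t\<^sup>2 * ((u t)\<^sup>2 + (v t)\<^sup>2)) * exp (\<bar>a\<bar> / t)"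
    have "(E has_real_derivative d) (at t)"
      unfolding E_def d_def using t
      by (auto intro!: derivative_eq_intros u v simp: power2_eq_square algebra_simps)
    moreover have "2 * u t * v t * a \<le> \<bar>a\<bar> * ((u t)\<^sup>2 + (v t)\<^sup>2)"
    proof -
      have "2 * \<bar>u t\<bar> * \<bar>v t\<bar> \<le> (u t)\<^sup>2 + (v t)\<^sup>2"
        using sum_squares_bound[of "\<bar>u t\<bar>" "\<bar>v t\<bar>"] by simp
      then have "\<bar>a\<bar> * (2 * \<bar>u t\<bar> * \<bar>v t\<bar>) \<le> \<bar>a\<bar> * ((u t)\<^sup>2 + (v t)\<^sup>2)"
        by (intro mult_left_mono) auto
      moreover have "2 * u t * v t * a \<le> \<bar>2 * u t * v t * a\<bar>" by (rule abs_ge_self)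
      ultimately show ?thesis by (simp add: abs_mult mult_ac)
    qed
    then have "d \<le> 0"
      unfolding d_def by (intro mult_nonpos_nonneg) (auto simp: divide_simps t)
    ultimately show "\<exists>d. (E has_real_derivative d) (at t) \<and> d \<le> 0" by blast
  qed
  have "(u y)\<^sup>2 * 1 \<le> ((u y)\<^sup>2 + (v y)\<^sup>2) * exp (\<bar>a\<bar> / y)"
    using \<open>y \<ge> 1\<close> by (intro mult_mono) auto
  then show ?thesis
    using \<open>E y \<le> E 1\<close> by (simp add: E_def)
qed

text \<open>\<open>u y = y powr (\<mu> + 1/2) * bessel_clifford \<mu> (y\<^sup>2 / 4)\<close> is, up to a constant, \<open>sqrt y * J\<^sub>\<mu> y\<close>
  and satisfies the Bessel equation in the normal form \<open>u'' = ((\<mu>\<^sup>2 - 1/4) / y\<^sup>2 - 1) * u\<close>.\<close>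

lemma bessel_clifford_oscillation_bound:
  assumes "\<mu> \<ge> 0"
  obtains C where "\<And>y. y \<ge> 1 \<Longrightarrow> y powr (\<mu> + 1/2) * \<bar>bessel_clifford \<mu> (y\<^sup>2 / 4)\<bar> \<le> C"
proof -
  let ?B = "\<lambda>m y. bessel_clifford (\<mu> + m) (y\<^sup>2 / 4)"
  define u where "u = (\<lambda>y. y powr (\<mu> + 1/2) * ?B 0 y)"
  define v where "v = (\<lambda>y. (\<mu> + 1/2) * y powr (\<mu> - 1/2) * ?B 0 y - y powr (\<mu> + 3/2) / 2 * ?B 1 y)"
  \<comment> \<open>Every power becomes an integer power of \<open>y\<close> times the same
    \<open>y powr (\<mu> - 3/2)\<close>, so the derivative identities below reduce to polynomial
    ones.\<close>
  have pw: "y powr (\<mu> + 1/2) = y\<^sup>2 * y powr (\<mu> - 3/2)" "y powr (\<mu> - 1/2) = y * y powr (\<mu> - 3/2)"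
    "y powr (\<mu> + 3/2) = y ^ 3 * y powr (\<mu> - 3/2)" if "y > 0" for y :: real
    using that by (simp_all flip: powr_add powr_numeral add: powr_mult_base algebra_simps)
  have B: "(?B m has_real_derivative - ?B (m + 1) y * (y / 2)) (at y)" if "m \<ge> 0" for m y
    using assms that
    by (auto intro!: derivative_eq_intros simp: algebra_simps)
  \<comment> \<open>Since differentiation raises the index, this relation is the Bessel equation in
    disguise; it is what closes the system for \<open>u\<close> and \<open>v\<close>.\<close>
  have rec: "?B 0 y = (\<mu> + 1) * ?B 1 y - y\<^sup>2 / 4 * ?B 2 y" for y
    using bessel_clifford_recurrence[OF assms] by simp
  have du: "(u has_real_derivative v y) (at y)" if "y > 0" for y
    unfolding u_def v_def using that
    by (auto intro!: derivative_eq_intros B simp: assms pw[OF that] powr_diff power2_eq_square)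
       (simp add: field_simps power3_eq_cube)
  have dv: "(v has_real_derivative ((\<mu>\<^sup>2 - 1/4) / y\<^sup>2 - 1) * u y) (at y)" if "y > 0" for y
  proof -
    have P1: "((\<lambda>y. y powr (\<mu> - 1/2)) has_real_derivative (\<mu> - 1/2) * y powr (\<mu> - 3/2)) (at y)"
      and P2: "((\<lambda>y. y powr (\<mu> + 3/2)) has_real_derivative (\<mu> + 3/2) * y powr (\<mu> + 1/2)) (at y)"
      using has_real_derivative_powr[OF that, of "\<mu> - 1/2"]
        has_real_derivative_powr[OF that, of "\<mu> + 3/2"] by (simp_all add: add.commute)
    have "(v has_real_derivative
       (\<mu> + 1/2) * ((\<mu> - 1/2) * y powr (\<mu> - 3/2)) * ?B 0 y
       + (\<mu> + 1/2) * y powr (\<mu> - 1/2) * (- ?B 1 y * (y / 2))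
       - ((\<mu> + 3/2) * y powr (\<mu> + 1/2) / 2 * ?B 1 y + y powr (\<mu> + 3/2) / 2 * (- ?B 2 y * (y / 2)))) (at y)"
      unfolding v_def
      by (rule DERIV_cong[OF DERIV_diff[OF
            DERIV_mult[OF DERIV_cmult[OF P1] B] DERIV_mult[OF DERIV_cdivide[OF P2] B]]])
         (simp_all add: algebra_simps)
    moreover have "(\<mu> + 1/2) * ((\<mu> - 1/2) * y powr (\<mu> - 3/2)) * ?B 0 y
       + (\<mu> + 1/2) * y powr (\<mu> - 1/2) * (- ?B 1 y * (y / 2))
       - ((\<mu> + 3/2) * y powr (\<mu> + 1/2) / 2 * ?B 1 y + y powr (\<mu> + 3/2) / 2 * (- ?B 2 y * (y / 2)))
       = ((\<mu>\<^sup>2 - 1/4) / y\<^sup>2 - 1) * u y"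
      unfolding u_def pw[OF that] rec using that
      by (simp add: field_simps power2_eq_square power3_eq_cube)
    ultimately show ?thesis by simp
  qed
  show ?thesis
  proof (rule that)
    fix y :: real assume "y \<ge> 1"
    from oscillator_bounded[OF du dv this]
    have "\<bar>u y\<bar> \<le> sqrt (((u 1)\<^sup>2 + (v 1)\<^sup>2) * exp \<bar>\<mu>\<^sup>2 - 1/4\<bar>)"
      by (metis real_sqrt_abs real_sqrt_le_mono)
    then show "y powr (\<mu> + 1/2) * \<bar>bessel_clifford \<mu> (y\<^sup>2 / 4)\<bar> \<le>
      sqrt (((u 1)\<^sup>2 + (v 1)\<^sup>2) * exp \<bar>\<mu>\<^sup>2 - 1/4\<bar>)"
      by (simp add: u_def abs_mult)
  qed
qed

text \<open>With \<open>w = y^2 / 4\<close> the exponent \<open>\<mu> + 1/2\<close> in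
  \<open>y\<close> becomes \<open>\<mu> / 2 + 1/4\<close> in \<open>w\<close>. The oscillation bound
  covers \<open>y \<ge> 1\<close>, that is \<open>w \<ge> 1/4\<close>, and compactness covers the
  rest; the shift to \<open>1 + w\<close> keeps the bound finite at 0.\<close>

lemma bessel_clifford_bound:
  assumes "\<mu> \<ge> 0"
  obtains C where "C \<ge> 0" "\<And>w. w \<ge> 0 \<Longrightarrow> \<bar>bessel_clifford \<mu> w\<bar> \<le> C * (1 + w) powr (- (\<mu> / 2 + 1/4))"
proof -
  let ?e = "\<mu> / 2 + 1/4"
  obtain C1 where C1: "\<And>y. y \<ge> 1 \<Longrightarrow> y powr (\<mu> + 1/2) * \<bar>bessel_clifford \<mu> (y\<^sup>2 / 4)\<bar> \<le> C1"
    using bessel_clifford_oscillation_bound[OF assms] by blast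
  have "continuous_on {0..1/4} (\<lambda>w. bessel_clifford \<mu> w * (1 + w) powr ?e)"
    using assms by (intro continuous_intros) auto
  then have "bounded ((\<lambda>w. bessel_clifford \<mu> w * (1 + w) powr ?e) ` {0..1/4})"
    using compact_continuous_image compact_imp_bounded by blast
  then obtain C2 where C2: "\<forall>w\<in>{0..1/4}. \<bar>bessel_clifford \<mu> w * (1 + w) powr ?e\<bar> \<le> C2"
    unfolding bounded_iff by auto
  define C where "C = max 0 (max C2 ((5/4) powr ?e * C1))"
  show ?thesis
  proof (rule that[of C])
    show "C \<ge> 0" by (simp add: C_def)
    fix w :: real assume w: "w \<ge> 0"
    have "\<bar>bessel_clifford \<mu> w\<bar> * (1 + w) powr ?e \<le> C"
    proof (cases "w \<le> 1/4")
      case True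
      then show ?thesis using bspec[OF C2, of w] w by (simp add: C_def abs_mult)
    next
      case False
      define y where "y = 2 * sqrt w"
      have y: "y \<ge> 1" "y\<^sup>2 / 4 = w" "y > 0"
        using False w real_sqrt_le_mono[of "1/4" w] by (auto simp: y_def power_mult_distrib real_sqrt_divide)
      \<comment> \<open>Here \<open>5/4 * y^2\<close> is \<open>5 * w\<close>, and
        \<open>1 + w \<le> 5 * w\<close> holds because \<open>w \<ge> 1/4\<close>.\<close>
      have "(1 + w) powr ?e \<le> (5/4 * y\<^sup>2) powr ?e"
        using False w y assms by (intro powr_mono2) auto
      also have "\<dots> = (5/4) powr ?e * y powr (2 * ?e)"
        using y powr_powr[of y 2 ?e] by (subst powr_mult) auto
      also have "2 * ?e = \<mu> + 1/2" by simp
      finally have "\<bar>bessel_clifford \<mu> w\<bar> * (1 + w) powr ?e \<le>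
          \<bar>bessel_clifford \<mu> w\<bar> * ((5/4) powr ?e * y powr (\<mu> + 1/2))"
        by (intro mult_left_mono) auto
      also have "\<dots> = (5/4) powr ?e * (y powr (\<mu> + 1/2) * \<bar>bessel_clifford \<mu> (y\<^sup>2 / 4)\<bar>)"
        using y by simp
      also have "\<dots> \<le> (5/4) powr ?e * C1"
        using C1[OF y(1)] by (intro mult_left_mono) auto
      finally show ?thesis by (simp add: C_def)
    qed
    then show "\<bar>bessel_clifford \<mu> w\<bar> \<le> C * (1 + w) powr (- ?e)"
      using w by (simp add: powr_minus field_simps)
  qed
qed

subsection \<open>Abel summation of the integral\<close>

text \<open>This covers conditional convergence: by \<open>has_integral_alt'\<close> it suffices to
  control the integrals over large bounded intervals, and these are differences of \<open>F\<close>.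
  The derivative is taken at interior points because the primitives contain real powers of
  \<open>c\<close>; continuity settles the endpoint.\<close>

lemma has_integral_atLeast_FTC:
  fixes F f :: "real \<Rightarrow> real"
  assumes cont: "continuous_on {a..} F"
    and deriv: "\<And>c. c > a \<Longrightarrow> (F has_real_derivative f c) (at c)"
    and lim: "(F \<longlongrightarrow> l) at_top"
  shows "(f has_integral (l - F a)) {a..}"
proof -
  have I: "(f has_integral (F t - F a)) {a..t}" if "a \<le> t" for t
    using that deriv
    by (intro fundamental_theorem_of_calculus_interior continuous_on_subset[OF cont])
       (auto simp: has_real_derivative_iff_has_vector_derivative)
  have int: "f integrable_on {max a u..v}" for u v
  proof (cases "a \<le> v")
    case True
    then show ?thesis
      by (intro integrable_on_subinterval[OF has_integral_integrable[OF I[OF True]]]) auto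
  qed auto
  have cut: "{a..} \<inter> {u..v} = {max a u..v}" for u v by auto
  show ?thesis
    unfolding has_integral_alt'
  proof (intro conjI allI impI)
    fix u v :: real
    show "(\<lambda>x. if x \<in> {a..} then f x else 0) integrable_on cbox u v"
      by (simp only: box_real integrable_restrict_Int cut int)
  next
    fix e :: real assume "e > 0"
    then obtain T where T: "\<And>t. t \<ge> T \<Longrightarrow> \<bar>F t - l\<bar> < e"
      using lim unfolding tendsto_iff eventually_at_top_linorder dist_real_def by blast
    show "\<exists>B>0. \<forall>u v. ball 0 B \<subseteq> cbox u v \<longrightarrow>
      norm (integral (cbox u v) (\<lambda>x. if x \<in> {a..} then f x else 0) - (l - F a)) < e"
    \<comment> \<open>A ball of this radius contains both \<open>a\<close> and \<open>T\<close>, so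
      an interval around it catches the lower limit and ends beyond \<open>T\<close>.\<close>
    proof (intro exI[of _ "\<bar>a\<bar> + \<bar>T\<bar> + 1"] conjI allI impI)
      fix u v :: real assume sub: "ball 0 (\<bar>a\<bar> + \<bar>T\<bar> + 1) \<subseteq> cbox u v"
      have "a \<in> cbox u v" "T \<in> cbox u v" by (rule subsetD[OF sub], simp)+
      then have "u \<le> a" "a \<le> v" "T \<le> v" by auto
      moreover from this have "integral (cbox u v) (\<lambda>x. if x \<in> {a..} then f x else 0) = F v - F a"
        using integral_unique[OF I[of v]] by (simp only: box_real integral_restrict_Int cut max_absorb1)
      ultimately show "norm (integral (cbox u v) (\<lambda>x. if x \<in> {a..} then f x else 0) - (l - F a)) < e"
        using T[of v] by simp
    qed auto
  qed
qed

text \<open>Integration by parts moves the damping factor off the conditionally convergent \<open>f\<close> onto the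
  absolutely integrable remainder \<open>r\<close>; the error term \<open>p * exp (- p * c) * F c\<close> is dominated
  because \<open>p * c * exp (- p * c) \<le> 1\<close>.\<close>

lemma abel_integral:
  fixes F f r D :: "real \<Rightarrow> real"
  assumes cont: "continuous_on {0..} F" "continuous_on {0..} r"
    and deriv: "\<And>c. c > 0 \<Longrightarrow> (F has_real_derivative f c - r c) (at c)"
    and lim: "(F \<longlongrightarrow> 0) at_top" and "F 0 = 0"
    and D: "D integrable_on {0..}"
    and r: "\<And>c. c \<ge> 0 \<Longrightarrow> \<bar>r c\<bar> \<le> D c" and F: "\<And>c. c \<ge> 0 \<Longrightarrow> \<bar>F c\<bar> \<le> c * D c"
  shows "(f has_integral integral {0..} r) {0..}"
    and "\<And>q. (\<And>n. q n > 0) \<Longrightarrow> q \<longlonglongrightarrow> 0 \<Longrightarrow>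
           (\<lambda>n. integral {0..} (\<lambda>c. exp (- q n * c) * f c)) \<longlonglongrightarrow> integral {0..} r"
proof -
  have r_int: "r integrable_on {0..}"
    by (intro measurable_bounded_by_integrable_imp_integrable[OF _ D]
        continuous_imp_measurable_on_sets_lebesgue cont) (use r in auto)
  from has_integral_add[OF has_integral_atLeast_FTC[OF cont(1) deriv lim] integrable_integral[OF this]]
  show "(f has_integral integral {0..} r) {0..}"
    using \<open>F 0 = 0\<close> by simp
  fix q :: "nat \<Rightarrow> real" assume q: "\<And>n. q n > 0" "q \<longlonglongrightarrow> 0"
  \<comment> \<open>The derivative of \<open>exp (- q n * c) * F c\<close> is
    \<open>exp (- q n * c) * f c - g n c\<close>. That product vanishes at 0 and at infinity, so
    \<open>g n\<close> has the same integral as the damped \<open>f\<close>, and dominated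
    convergence applies to \<open>g n\<close>.\<close>
  define g where "g = (\<lambda>n c. exp (- q n * c) * r c + q n * exp (- q n * c) * F c)"
  have exp_le: "exp (- q n * c) \<le> 1" if "c \<ge> 0" for n c
    using q(1)[of n] that by simp
  have Fq: "\<bar>q n * exp (- q n * c) * F c\<bar> \<le> D c" if "c \<ge> 0" for n c
  proof -
    have "q n * c * exp (- q n * c) \<le> 1"
      using order_trans[OF _ exp_ge_add_one_self[of "q n * c"], of "q n * c"]
      by (simp add: exp_minus field_simps)
    moreover have "\<bar>q n * exp (- q n * c) * F c\<bar> \<le> q n * exp (- q n * c) * (c * D c)"
      using q(1)[of n] F[OF that] by (simp add: abs_mult)
    moreover have "D c \<ge> 0" using r[OF that] by linarith
    ultimately show ?thesis
      using mult_right_mono[of "q n * c * exp (- q n * c)" 1 "D c"] by (simp add: mult_ac)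
  qed
  have g_le: "\<bar>g n c\<bar> \<le> 2 * D c" if "c \<ge> 0" for n c
  proof -
    have "\<bar>exp (- q n * c) * r c\<bar> \<le> 1 * D c"
      unfolding abs_mult using exp_le[OF that] r[OF that] by (intro mult_mono) auto
    then show ?thesis
      using Fq[OF that, of n] by (simp add: g_def)
  qed
  have D2: "(\<lambda>c. 2 * D c) integrable_on {0..}"
    using D by (rule integrable_on_mult_right)
  have g_int: "g n integrable_on {0..}" for n
    by (intro measurable_bounded_by_integrable_imp_integrable[OF _ D2]
        continuous_imp_measurable_on_sets_lebesgue)
       (use g_le in \<open>auto simp: g_def intro!: continuous_intros cont\<close>)
  have "integral {0..} (\<lambda>c. exp (- q n * c) * f c) = integral {0..} (g n)" for n
  proof -
    have "((\<lambda>c. exp (- q n * c) * F c) \<longlongrightarrow> 0) at_top"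
    proof (rule Lim_null_comparison[OF _ tendsto_rabs_zero[OF lim]])
      show "\<forall>\<^sub>F c in at_top. norm (exp (- q n * c) * F c) \<le> \<bar>F c\<bar>"
        using eventually_ge_at_top[of 0]
      proof eventually_elim
        case (elim c)
        then show ?case
          using mult_right_mono[OF exp_le[OF elim, of n], of "\<bar>F c\<bar>"] by (simp add: abs_mult)
      qed
    qed
    moreover have "((\<lambda>c. exp (- q n * c) * F c) has_real_derivative exp (- q n * c) * f c - g n c) (at c)"
      if "c > 0" for c
      using that unfolding g_def
      by (auto intro!: derivative_eq_intros deriv simp: algebra_simps)
    ultimately have "((\<lambda>c. exp (- q n * c) * f c - g n c) has_integral (0 - exp (- q n * 0) * F 0)) {0..}"
      by (intro has_integral_atLeast_FTC[where F = "\<lambda>c. exp (- q n * c) * F c"])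
         (auto intro!: continuous_intros cont)
    from has_integral_add[OF this integrable_integral[OF g_int[of n]]] show ?thesis
      using \<open>F 0 = 0\<close> by (simp add: integral_unique)
  qed
  moreover have "(\<lambda>n. integral {0..} (g n)) \<longlonglongrightarrow> integral {0..} r"
  proof (rule dominated_convergence(2)[OF g_int D2])
    fix c :: real
    have "(\<lambda>n. g n c) \<longlonglongrightarrow> exp (- 0 * c) * r c + 0 * exp (- 0 * c) * F c"
      unfolding g_def by (intro tendsto_intros q)
    then show "(\<lambda>n. g n c) \<longlonglongrightarrow> r c" by simp
  qed (use g_le in auto)
  ultimately show "(\<lambda>n. integral {0..} (\<lambda>c. exp (- q n * c) * f c)) \<longlonglongrightarrow> integral {0..} r"
    by simp
qed

text \<open>The decay bounds give only the order \<open>c powr (- 3/4)\<close> for the integrand,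
  too little for absolute integrability. After a derivative is split off, the remainder is of order
  \<open>c powr (- 5/4)\<close>, and \<open>abel_integral\<close> applies.\<close>

lemma bessel_product_abel_integral:
  fixes \<nu> x :: real
  assumes "\<nu> > 0" "x > 0"
  defines "f \<equiv> \<lambda>c. (x / 2) powr \<nu> * c powr (2 * \<nu>) *
    bessel_clifford \<nu> ((c * x / 2)\<^sup>2) * bessel_clifford (2 * \<nu>) c"
  obtains I where "(f has_integral I) {0..}"
    "\<And>q. (\<And>n. q n > 0) \<Longrightarrow> q \<longlonglongrightarrow> 0 \<Longrightarrow>
       (\<lambda>n. integral {0..} (\<lambda>c. exp (- q n * c) * f c)) \<longlonglongrightarrow> I"
proof -
  let ?A = "\<lambda>m c. bessel_clifford (\<nu> + m) ((c * x / 2)\<^sup>2)"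
  let ?B = "\<lambda>m c. bessel_clifford (2 * \<nu> + m) c"
  define K where "K = (x / 2) powr \<nu> / 2"
  have K: "K > 0" using assms by (simp add: K_def)
  \<comment> \<open>When the recurrence is inserted for \<open>?A 0\<close>, the terms with
    \<open>?A 2\<close> cancel in \<open>f c\<close> minus the derivative of \<open>F\<close>; what
    remains is \<open>r\<close>.\<close>
  define F where "F = (\<lambda>c. K * (c powr (2 * \<nu> + 1) * ?A 1 c * ?B 0 c))"
  define r where "r = (\<lambda>c. K * (c powr (2 * \<nu>) * ?A 1 c * ?B 0 c + c powr (2 * \<nu> + 1) * ?A 1 c * ?B 1 c))"
  have cont_powr: "continuous_on {0..} (\<lambda>c::real. c powr s)" if "s > 0" for s
    using that by (intro continuous_on_powr') auto
  have cont: "continuous_on {0..} F" "continuous_on {0..} r"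
    unfolding F_def r_def using assms
    by (auto intro!: continuous_on_mult continuous_on_add continuous_on_const cont_powr
        continuous_on_bessel_clifford continuous_on_power continuous_on_divide continuous_on_id)
  have deriv: "(F has_real_derivative f c - r c) (at c)" if "c > 0" for c
  proof -
    have dA: "(?A 1 has_real_derivative - ?A 2 c * (c * x\<^sup>2 / 2)) (at c)"
      using assms by (auto intro!: derivative_eq_intros simp: power2_eq_square add.assoc)
    have dB: "(?B 0 has_real_derivative - ?B 1 c) (at c)"
      using assms by (auto intro!: derivative_eq_intros)
    have dP: "((\<lambda>c. c powr (2 * \<nu> + 1)) has_real_derivative (2 * \<nu> + 1) * c powr (2 * \<nu>)) (at c)"
      using has_real_derivative_powr[OF that, of "2 * \<nu> + 1"] by simp
    have rec: "?A 0 c = (\<nu> + 1) * ?A 1 c - (c * x / 2)\<^sup>2 * ?A 2 c"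
      using bessel_clifford_recurrence[of \<nu>] assms by simp
    have f_eq: "f c = 2 * K * c powr (2 * \<nu>) * ?A 0 c * ?B 0 c"
      by (simp add: f_def K_def)
    have pw: "c powr (2 * \<nu> + 1) = c * c powr (2 * \<nu>)"
      using that by (simp add: powr_add)
    show ?thesis
      unfolding F_def
      by (rule DERIV_cong[OF DERIV_cmult[OF DERIV_mult[OF DERIV_mult[OF dP dA] dB]]])
         (unfold f_eq r_def rec pw, simp add: power2_eq_square algebra_simps)
  qed
  obtain C1 where C1: "C1 \<ge> 0"
    "\<And>w. w \<ge> 0 \<Longrightarrow> \<bar>bessel_clifford (\<nu> + 1) w\<bar> \<le> C1 * (1 + w) powr (- ((\<nu> + 1) / 2 + 1/4))"
    using bessel_clifford_bound[of "\<nu> + 1"] assms by auto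
  obtain C2 where C2: "C2 \<ge> 0"
    "\<And>w. w \<ge> 0 \<Longrightarrow> \<bar>?B 0 w\<bar> \<le> C2 * (1 + w) powr (- ((2 * \<nu> + 0) / 2 + 1/4))"
    using bessel_clifford_bound[of "2 * \<nu> + 0"] assms by auto
  obtain C3 where C3: "C3 \<ge> 0"
    "\<And>w. w \<ge> 0 \<Longrightarrow> \<bar>?B 1 w\<bar> \<le> C3 * (1 + w) powr (- ((2 * \<nu> + 1) / 2 + 1/4))"
    using bessel_clifford_bound[of "2 * \<nu> + 1"] assms by auto
  \<comment> \<open>Chosen so that \<open>\<kappa> * (1 + c)^2 \<le> 1 + (c * x / 2)^2\<close>: the
    half pays for \<open>(1 + c)^2 \<le> 2 * (1 + c^2)\<close>, the minimum for the constant and the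
    quadratic coefficient. This turns decay in \<open>(c * x / 2)^2\<close> into decay in
    \<open>1 + c\<close>.\<close>
  define \<kappa> where "\<kappa> = min 1 (x\<^sup>2 / 4) / 2"
  have \<kappa>: "\<kappa> > 0" using assms by (simp add: \<kappa>_def)
  define M where "M = C1 * \<kappa> powr (- (\<nu> / 2 + 3/4))"
  have M: "M \<ge> 0" using C1 by (simp add: M_def)
  have A1: "\<bar>?A 1 c\<bar> \<le> M * (1 + c) powr (- (\<nu> + 3/2))" if "c \<ge> 0" for c
  proof -
    have "(1 + c)\<^sup>2 \<le> 2 * (1 + c\<^sup>2)"
      using sum_squares_bound[of 1 c] by (simp add: power2_eq_square algebra_simps)
    then have "\<kappa> * (1 + c)\<^sup>2 \<le> \<kappa> * (2 * (1 + c\<^sup>2))"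
      using \<kappa> by (intro mult_left_mono) auto
    also have "\<dots> = min 1 (x\<^sup>2 / 4) * 1 + min 1 (x\<^sup>2 / 4) * c\<^sup>2"
      by (simp add: \<kappa>_def algebra_simps)
    also have "\<dots> \<le> 1 * 1 + (x\<^sup>2 / 4) * c\<^sup>2"
      by (intro add_mono mult_right_mono) auto
    also have "\<dots> = 1 + (c * x / 2)\<^sup>2"
      by (simp add: power_mult_distrib power_divide)
    finally have le: "\<kappa> * (1 + c)\<^sup>2 \<le> 1 + (c * x / 2)\<^sup>2" .
    have "\<bar>?A 1 c\<bar> \<le> C1 * (1 + (c * x / 2)\<^sup>2) powr (- (\<nu> / 2 + 3/4))"
      using C1(2)[of "(c * x / 2)\<^sup>2"] by (simp add: add_divide_distrib algebra_simps)
    also have "\<dots> \<le> C1 * (\<kappa> * (1 + c)\<^sup>2) powr (- (\<nu> / 2 + 3/4))"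
      using \<kappa> that assms by (intro mult_left_mono powr_mono2' le C1) auto
    also have "(\<kappa> * (1 + c)\<^sup>2) powr (- (\<nu> / 2 + 3/4)) =
        \<kappa> powr (- (\<nu> / 2 + 3/4)) * (1 + c) powr (- (\<nu> + 3/2))"
      using \<kappa> that powr_powr[of "1 + c" 2 "- (\<nu> / 2 + 3/4)"] by (simp add: powr_mult)
    finally show ?thesis by (simp add: M_def)
  qed
  have p_le: "c powr s \<le> (1 + c) powr s" if "c \<ge> 0" "s > 0" for c s :: real
    using that by (intro powr_mono2) auto
  have b0: "\<bar>c powr (2 * \<nu>) * ?A 1 c * ?B 0 c\<bar> \<le> M * C2 * (1 + c) powr (- 7/4)" if "c \<ge> 0" for c
  proof -
    have "\<bar>c powr (2 * \<nu>) * ?A 1 c * ?B 0 c\<bar> \<le> (1 + c) powr (2 * \<nu>) *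
      (M * (1 + c) powr (- (\<nu> + 3/2))) * (C2 * (1 + c) powr (- ((2 * \<nu> + 0) / 2 + 1/4)))"
      unfolding abs_mult
      using assms that M C2(1) by (intro mult_mono A1 C2(2)) (auto intro!: p_le)
    also have "\<dots> = M * C2 * ((1 + c) powr (2 * \<nu>) * (1 + c) powr (- (\<nu> + 3/2)) *
      (1 + c) powr (- ((2 * \<nu> + 0) / 2 + 1/4)))"
      by (simp add: mult_ac)
    also have "(1 + c) powr (2 * \<nu>) * (1 + c) powr (- (\<nu> + 3/2)) *
      (1 + c) powr (- ((2 * \<nu> + 0) / 2 + 1/4)) = (1 + c) powr (- 7/4)"
      by (simp flip: powr_add)
    finally show ?thesis .
  qed
  have b1: "\<bar>c powr (2 * \<nu> + 1) * ?A 1 c * ?B 1 c\<bar> \<le> M * C3 * (1 + c) powr (- 5/4)" if "c \<ge> 0" for c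
  proof -
    have "\<bar>c powr (2 * \<nu> + 1) * ?A 1 c * ?B 1 c\<bar> \<le> (1 + c) powr (2 * \<nu> + 1) *
      (M * (1 + c) powr (- (\<nu> + 3/2))) * (C3 * (1 + c) powr (- ((2 * \<nu> + 1) / 2 + 1/4)))"
      unfolding abs_mult
      using assms that M C3(1) by (intro mult_mono A1 C3(2)) (auto intro!: p_le)
    also have "\<dots> = M * C3 * ((1 + c) powr (2 * \<nu> + 1) * (1 + c) powr (- (\<nu> + 3/2)) *
      (1 + c) powr (- ((2 * \<nu> + 1) / 2 + 1/4)))"
      by (simp add: mult_ac)
    also have "(1 + c) powr (2 * \<nu> + 1) * (1 + c) powr (- (\<nu> + 3/2)) *
      (1 + c) powr (- ((2 * \<nu> + 1) / 2 + 1/4)) = (1 + c) powr (- 5/4)"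
      by (simp flip: powr_add) (simp add: add_divide_distrib)
    finally show ?thesis .
  qed
  \<comment> \<open>The two terms of \<open>r\<close> decay with exponents \<open>- 7/4\<close> and
    \<open>- 5/4\<close>. The slower one gives the majorant, which also dominates
    \<open>F c / c\<close> as \<open>abel_integral\<close> requires.\<close>
  define D where "D = (\<lambda>c. K * (M * (C2 + C3)) * (1 + c) powr (- 5/4))"
  have decay: "((\<lambda>c::real. (1 + c) powr (- s)) \<longlongrightarrow> 0) at_top" if "s > 0" for s :: real
    by (rule tendsto_neg_powr)
       (use that in \<open>auto intro!: filterlim_tendsto_add_at_top[OF tendsto_const] filterlim_ident\<close>)
  have D_int: "D integrable_on {0..}"
    unfolding D_def
  proof (intro integrable_on_mult_right)
    have "((\<lambda>c::real. (1 + c) powr (- 5/4)) has_integral (- 4 * 0 - (- 4 * (1 + 0) powr (- (1/4))))) {0..}"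
    proof (rule has_integral_atLeast_FTC)
      show "continuous_on {0..} (\<lambda>c::real. - 4 * (1 + c) powr (- (1/4)))"
        by (intro continuous_intros) auto
      show "((\<lambda>c::real. - 4 * (1 + c) powr (- (1/4))) \<longlongrightarrow> - 4 * 0) at_top"
        by (intro tendsto_mult tendsto_const decay) auto
    qed (auto intro!: derivative_eq_intros)
    then show "(\<lambda>c::real. (1 + c) powr (- 5/4)) integrable_on {0..}" by blast
  qed
  have b0': "\<bar>c powr (2 * \<nu>) * ?A 1 c * ?B 0 c\<bar> \<le> M * C2 * (1 + c) powr (- 5/4)" if "c \<ge> 0" for c
    using that M C2(1) by (intro order_trans[OF b0] mult_left_mono powr_mono) auto
  have r_le: "\<bar>r c\<bar> \<le> D c" if "c \<ge> 0" for c
  proof -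
    have "\<bar>r c\<bar> = K * \<bar>c powr (2 * \<nu>) * ?A 1 c * ?B 0 c + c powr (2 * \<nu> + 1) * ?A 1 c * ?B 1 c\<bar>"
      using K by (simp add: r_def abs_mult)
    also have "\<dots> \<le> K * (M * C2 * (1 + c) powr (- 5/4) + M * C3 * (1 + c) powr (- 5/4))"
      using K by (intro mult_left_mono order_trans[OF abs_triangle_ineq] add_mono b0' b1 that) auto
    finally show ?thesis by (simp add: D_def algebra_simps)
  qed
  have F_eq: "\<bar>F c\<bar> = K * (c * \<bar>c powr (2 * \<nu>) * ?A 1 c * ?B 0 c\<bar>)" if "c \<ge> 0" for c
    using K that by (simp add: F_def abs_mult powr_mult_base mult_ac add_ac)
  have F_le: "\<bar>F c\<bar> \<le> c * D c" if "c \<ge> 0" for c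
  proof -
    have "M * C2 * (1 + c) powr (- 5/4) \<le> M * (C2 + C3) * (1 + c) powr (- 5/4)"
      using M C3(1) by (intro mult_left_mono mult_right_mono) auto
    then have "K * (c * \<bar>c powr (2 * \<nu>) * ?A 1 c * ?B 0 c\<bar>) \<le> K * (c * (M * (C2 + C3) * (1 + c) powr (- 5/4)))"
      using K that b0'[OF that] by (intro mult_left_mono) auto
    then show ?thesis using F_eq[OF that] by (simp add: D_def mult_ac)
  qed
  have lim: "(F \<longlongrightarrow> 0) at_top"
  proof (rule Lim_null_comparison)
    show "\<forall>\<^sub>F c in at_top. norm (F c) \<le> K * (M * C2) * (1 + c) powr (- (3/4))"
      using eventually_ge_at_top[of 0]
    proof eventually_elim
      case (elim c)
      have "\<bar>F c\<bar> \<le> K * ((1 + c) * (M * C2 * (1 + c) powr (- 7/4)))"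
        unfolding F_eq[OF elim] using K elim b0[OF elim] by (intro mult_left_mono mult_mono) auto
      also have "\<dots> = K * (M * C2) * ((1 + c) * (1 + c) powr (- 7/4))" by (simp add: mult_ac)
      also have "(1 + c) * (1 + c) powr (- 7/4) = (1 + c) powr (- (3/4))"
        using elim by (simp add: powr_mult_base)
      finally show ?case by simp
    qed
    show "((\<lambda>c. K * (M * C2) * (1 + c) powr (- (3/4))) \<longlongrightarrow> 0) at_top"
      by (intro tendsto_mult_right_zero decay) auto
  qed
  have "F 0 = 0" by (simp add: F_def)
  from abel_integral[OF cont deriv lim this D_int r_le F_le] show ?thesis
    by (intro that) blast+
qed

subsection \<open>Laplace transforms and power series\<close>

text \<open>Used to read off derivatives twice: from the moment expansion of a Laplace transform and
  from the binomial series at 0.\<close>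

lemma power_series_coeff_unique:
  fixes f :: "complex \<Rightarrow> complex"
  assumes "r > 0" and "\<And>w. w \<in> ball z r \<Longrightarrow> (\<lambda>n. a n * (w - z) ^ n) sums f w"
  shows "a n = (deriv ^^ n) f z / fact n"
proof -
  have ev: "eventually (\<lambda>u. u \<in> ball 0 r) (nhds (0 :: complex))"
    using \<open>r > 0\<close> by (intro eventually_nhds_in_open) auto
  have hol: "f holomorphic_on ball z r"
    using assms(2) by (rule power_series_holomorphic)
  have "(\<lambda>u. f (z + u)) has_fps_expansion Abs_fps a"
  proof (intro has_fps_expansionI eventually_mono[OF ev])
    fix u :: complex assume "u \<in> ball 0 r"
    then show "(\<lambda>n. fps_nth (Abs_fps a) n * u ^ n) sums f (z + u)"
      using assms(2)[of "z + u"] by (simp add: dist_norm)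
  qed
  moreover have "(\<lambda>u. f (z + u)) has_fps_expansion Abs_fps (\<lambda>n. (deriv ^^ n) f z / fact n)"
  proof (intro has_fps_expansionI eventually_mono[OF ev])
    fix u :: complex assume "u \<in> ball 0 r"
    then show "(\<lambda>n. fps_nth (Abs_fps (\<lambda>n. (deriv ^^ n) f z / fact n)) n * u ^ n) sums f (z + u)"
      using holomorphic_power_series[OF hol, of "z + u"] by (simp add: dist_norm)
  qed
  ultimately show ?thesis
    using fps_expansion_unique_complex by (metis fps_nth_Abs_fps)
qed

text \<open>Dominated convergence applied to the partial sums. Bounding the partial sums of the
  norms by \<open>D\<close> controls the single terms as well.\<close>

lemma integral_sums_dominated:
  fixes g :: "nat \<Rightarrow> real \<Rightarrow> 'a::euclidean_space"
  assumes cont: "\<And>k. continuous_on S (g k)" and S: "S \<in> sets lebesgue"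
    and D: "D integrable_on S"
    and le: "\<And>n c. c \<in> S \<Longrightarrow> (\<Sum>k<n. norm (g k c)) \<le> D c"
    and sums: "\<And>c. c \<in> S \<Longrightarrow> (\<lambda>k. g k c) sums s c"
  shows "g k integrable_on S" and "s integrable_on S"
    and "(\<lambda>k. integral S (g k)) sums integral S s"
proof -
  show int: "g k integrable_on S" for k
  proof (rule measurable_bounded_by_integrable_imp_integrable[OF _ D _ S])
    fix c assume "c \<in> S"
    then show "norm (g k c) \<le> D c"
      using le[of c "Suc k"] sum_nonneg[of "{..<k}" "\<lambda>k. norm (g k c)"] by simp
  qed (intro continuous_imp_measurable_on_sets_lebesgue cont S)
  have sum_int: "(\<lambda>c. \<Sum>k<n. g k c) integrable_on S" for n
    using int by (intro integrable_sum) auto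
  have norm_le: "norm (\<Sum>k<n. g k c) \<le> D c" if "c \<in> S" for n c
    using norm_sum le[OF that] by (rule order_trans)
  have conv: "(\<lambda>n. \<Sum>k<n. g k c) \<longlonglongrightarrow> s c" if "c \<in> S" for c
    using sums[OF that] by (simp add: sums_def)
  show "s integrable_on S"
    by (rule dominated_convergence(1)[OF sum_int D norm_le conv])
  show "(\<lambda>k. integral S (g k)) sums integral S s"
    using dominated_convergence(2)[OF sum_int D norm_le conv]
    by (simp add: sums_def integral_sum int)
qed

lemma exp_series_partial_le:
  assumes "(y::real) \<ge> 0"
  shows "(\<Sum>k<n. y ^ k / fact k) \<le> exp y"
  using sum_le_suminf[OF summable_exp[of y], of "{..<n}"] assms
  by (simp add: exp_def field_simps)

text \<open>Substitute \<open>t = p * c\<close> in Euler's integral. The change of variables formula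
  is one for absolutely integrable functions, which nonnegativity provides.\<close>

lemma laplace_gamma_integral:
  fixes s p :: real
  assumes "s > -1" "p > 0"
  shows "((\<lambda>c. exp (- p * c) * c powr s) has_integral Gamma (s + 1) / p powr (s + 1)) {0..}"
proof -
  have I: "((\<lambda>t. t powr s / exp t) has_integral Gamma (s + 1)) {0..}"
    using Gamma_integral_real[of "s + 1"] assms by simp
  then have "(\<lambda>t. t powr s / exp t) absolutely_integrable_on {0..}"
    by (intro nonnegative_absolutely_integrable_1) auto
  moreover have im: "(\<lambda>c. p * c) ` {0..} = {0..}"
  proof (intro equalityI subsetI)
    fix t :: real assume "t \<in> {0..}"
    then show "t \<in> (\<lambda>c. p * c) ` {0..}"
      using assms by (intro image_eqI[of _ _ "t / p"]) auto
  qed (use assms in auto)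
  ultimately have "(\<lambda>c. \<bar>p\<bar> * ((p * c) powr s / exp (p * c))) absolutely_integrable_on {0..} \<and>
    integral {0..} (\<lambda>c. \<bar>p\<bar> * ((p * c) powr s / exp (p * c))) = Gamma (s + 1)"
    using integral_unique[OF I] assms
    by (subst has_absolute_integral_change_of_variables_1'[where g = "\<lambda>c. p * c"])
       (auto intro!: derivative_eq_intros inj_onI)
  then have "((\<lambda>c. \<bar>p\<bar> * ((p * c) powr s / exp (p * c))) has_integral Gamma (s + 1)) {0..}"
    by (metis absolutely_integrable_on_def integrable_integral)
  from has_integral_mult_right[OF this, of "1 / p powr (s + 1)"]
  have "((\<lambda>c. 1 / p powr (s + 1) * (\<bar>p\<bar> * ((p * c) powr s / exp (p * c)))) has_integral
    Gamma (s + 1) / p powr (s + 1)) {0..}" by simp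
  then show ?thesis
    by (rule has_integral_eq[rotated])
       (use assms in \<open>auto simp: powr_mult powr_add exp_minus field_simps\<close>)
qed

text \<open>Expand \<open>exp (- (w - p) * c)\<close> under the integral. With
  \<open>r = norm (w - p) < p\<close> the partial sums of the norms stay below
  \<open>exp (- (p - r) * c) * \<bar>g c\<bar>\<close>, which still decays; hence the disc of radius
  \<open>p\<close>.\<close>

lemma laplace_transform_power_series:
  fixes g :: "real \<Rightarrow> real" and p :: real
  assumes cont: "continuous_on {0..} g" and int: "\<And>s. s > 0 \<Longrightarrow> (\<lambda>c. exp (- s * c) * \<bar>g c\<bar>) integrable_on {0..}"
    and p: "p > 0" and w: "w \<in> ball (complex_of_real p) p"
  shows "(\<lambda>k. complex_of_real ((-1) ^ k / fact k * integral {0..} (\<lambda>c. exp (- p * c) * c ^ k * g c)) *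
           (w - of_real p) ^ k) sums
         integral {0..} (\<lambda>c. exp (- w * of_real c) * of_real (g c))"
proof -
  define r where "r = norm (w - of_real p)"
  have r: "0 \<le> r" "r < p"
    using w by (auto simp: r_def dist_norm norm_minus_commute)
  define h where "h = (\<lambda>k c. (of_real p - w) ^ k / fact k * complex_of_real (exp (- p * c) * c ^ k * g c))"
  have D: "(\<lambda>c. exp (- (p - r) * c) * \<bar>g c\<bar>) integrable_on {0..}"
    using int[of "p - r"] r by simp
  have h_cont: "continuous_on {0..} (h k)" for k
    unfolding h_def by (intro continuous_intros cont) auto
  have le: "(\<Sum>k<n. norm (h k c)) \<le> exp (- (p - r) * c) * \<bar>g c\<bar>" if "c \<in> {0..}" for n c
  proof -
    have "(\<Sum>k<n. norm (h k c)) = (\<Sum>k<n. (r * c) ^ k / fact k) * (exp (- p * c) * \<bar>g c\<bar>)"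
      using that
      by (auto simp: h_def r_def norm_mult norm_divide norm_power abs_mult power_mult_distrib
          norm_minus_commute sum_distrib_right intro!: sum.cong)
    also have "\<dots> \<le> exp (r * c) * (exp (- p * c) * \<bar>g c\<bar>)"
      using that r by (intro mult_right_mono exp_series_partial_le) auto
    also have "\<dots> = exp (- (p - r) * c) * \<bar>g c\<bar>"
      by (simp add: mult_exp_exp algebra_simps flip: mult.assoc)
    finally show ?thesis .
  qed
  have sums: "(\<lambda>k. h k c) sums (exp (- w * of_real c) * of_real (g c))" for c
  proof -
    have "(\<lambda>k. ((of_real p - w) * of_real c) ^ k /\<^sub>R fact k * of_real (exp (- p * c) * g c))
      sums (exp ((of_real p - w) * of_real c) * of_real (exp (- p * c) * g c))"
      by (intro sums_mult2 exp_converges)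
    also have "exp ((of_real p - w) * of_real c) * of_real (exp (- p * c) * g c) =
      exp (- w * of_real c) * of_real (g c)"
    proof -
      have "exp ((of_real p - w) * of_real c) * of_real (exp (- p * c)) = exp (- w * of_real c)"
        unfolding exp_of_real[symmetric] mult_exp_exp by (simp add: algebra_simps)
      then show ?thesis by (simp only: of_real_mult mult.assoc[symmetric])
    qed
    also have "(\<lambda>k. ((of_real p - w) * of_real c) ^ k /\<^sub>R fact k * of_real (exp (- p * c) * g c)) = (\<lambda>k. h k c)"
      unfolding h_def power_mult_distrib scaleR_conv_of_real
      by (simp add: fun_eq_iff divide_inverse mult_ac)
    finally show ?thesis .
  qed
  have lb: "({0..} :: real set) \<in> sets lebesgue" by simp
  note dom = integral_sums_dominated[OF h_cont lb D le sums]
  have "integral {0..} (h k) = complex_of_real ((-1) ^ k / fact k *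
    integral {0..} (\<lambda>c. exp (- p * c) * c ^ k * g c)) * (w - of_real p) ^ k" for k
  proof -
    have "(\<lambda>c. exp (- p * c) * c ^ k * g c) integrable_on {0..}"
    proof (rule measurable_bounded_by_integrable_imp_integrable)
      show "(\<lambda>c. exp (- p * c) * c ^ k * g c) \<in> borel_measurable (lebesgue_on {0..})"
        by (intro continuous_imp_measurable_on_sets_lebesgue continuous_intros cont) auto
      \<comment> \<open>Half of the damping absorbs the power: \<open>c ^ k\<close> is at most
        \<open>fact k / (p / 2) ^ k * exp (p / 2 * c)\<close>.\<close>
      show "(\<lambda>c. fact k / (p / 2) ^ k * (exp (- (p / 2) * c) * \<bar>g c\<bar>)) integrable_on {0..}"
        using p by (intro integrable_on_mult_right int) auto
      fix c :: real assume c: "c \<in> {0..}"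
      have "(p / 2 * c) ^ k / fact k \<le> exp (p / 2 * c)"
        using exp_series_partial_le[of "p / 2 * c" "Suc k"] c p
          sum_nonneg[of "{..<k}" "\<lambda>k. (p / 2 * c) ^ k / fact k"] by simp
      then have "c ^ k \<le> fact k / (p / 2) ^ k * exp (p / 2 * c)"
        using p by (simp add: power_mult_distrib field_simps)
      then have "exp (- p * c) * c ^ k * \<bar>g c\<bar> \<le>
          exp (- p * c) * (fact k / (p / 2) ^ k * exp (p / 2 * c)) * \<bar>g c\<bar>"
        by (intro mult_left_mono mult_right_mono) auto
      also have "\<dots> = fact k / (p / 2) ^ k * ((exp (- p * c) * exp (p / 2 * c)) * \<bar>g c\<bar>)"
        by (simp only: mult_ac)
      also have "exp (- p * c) * exp (p / 2 * c) = exp (- (p / 2) * c)"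
        by (simp add: mult_exp_exp)
      finally show "norm (exp (- p * c) * c ^ k * g c) \<le>
          fact k / (p / 2) ^ k * (exp (- (p / 2) * c) * \<bar>g c\<bar>)"
        using c by (simp add: abs_mult)
    qed auto
    from has_integral_mult_right[OF has_integral_of_real[OF integrable_integral[OF this],
        where ?'b = complex], of "(of_real p - w) ^ k / fact k"]
    have "integral {0..} (h k) = (of_real p - w) ^ k / fact k *
        complex_of_real (integral {0..} (\<lambda>c. exp (- p * c) * c ^ k * g c))"
      unfolding h_def by (rule integral_unique)
    also have "(of_real p - w) ^ k = (-1) ^ k * (w - of_real p) ^ k"
      by (simp flip: power_mult_distrib)
    finally show ?thesis by simp
  qed
  with dom(3) show ?thesis by simp
qed

text \<open>Repeated differentiation under the integral sign, for a Laplace transform that is known in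
  closed form only for large real arguments.\<close>

lemma laplace_moments_analytic:
  fixes g :: "real \<Rightarrow> real" and p :: real
  assumes cont: "continuous_on {0..} g" and int: "\<And>s. s > 0 \<Longrightarrow> (\<lambda>c. exp (- s * c) * \<bar>g c\<bar>) integrable_on {0..}"
    and G: "G holomorphic_on {p. Re p > 0}"
    and eq: "\<And>t. t > x \<Longrightarrow> integral {0..} (\<lambda>c. exp (- t * c) * g c) = T t"
      "\<And>t. t > x \<Longrightarrow> G (complex_of_real t) = of_real (T t)"
    and x: "x \<ge> 0" and p: "p > 0"
  shows "complex_of_real ((-1) ^ k / fact k * integral {0..} (\<lambda>c. exp (- p * c) * c ^ k * g c)) =
           (deriv ^^ k) G (of_real p) / fact k"
proof -
  define L where "L = (\<lambda>w. integral {0..} (\<lambda>c. exp (- w * of_real c) * complex_of_real (g c)))"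
  have ps: "(\<lambda>k. complex_of_real ((-1) ^ k / fact k * integral {0..} (\<lambda>c. exp (- t * c) * c ^ k * g c)) *
      (w - of_real t) ^ k) sums L w" if "t > 0" "w \<in> ball (of_real t) t" for t w
    unfolding L_def by (rule laplace_transform_power_series[OF cont int that])
  have op: "open {p. Re p > 0}" by (simp add: open_halfspace_Re_gt)
  \<comment> \<open>The discs with centre \<open>t\<close> and radius \<open>t\<close> exhaust the
    right half-plane: for \<open>t = norm w ^ 2 / Re w\<close> the squared distance from
    \<open>w\<close> to \<open>t\<close> is \<open>t ^ 2 - norm w ^ 2\<close>.\<close>
  have cover: "\<exists>t>0. w \<in> ball (complex_of_real t) t" if "Re w > 0" for w
  proof -
    define t where "t = norm w ^ 2 / Re w"
    have t: "t > 0" using that by (auto simp: t_def complex_eq_iff)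
    have "norm (w - of_real t) ^ 2 = norm w ^ 2 - 2 * t * Re w + t ^ 2"
      unfolding cmod_power2 by (simp add: power2_eq_square algebra_simps)
    also have "2 * t * Re w = 2 * norm w ^ 2"
      using that by (simp add: t_def)
    also have "norm w ^ 2 - 2 * norm w ^ 2 + t ^ 2 < t ^ 2"
      using that by (auto simp: complex_eq_iff)
    finally have "norm (w - of_real t) < t"
      using t by (auto intro: power2_less_imp_less)
    with t show ?thesis by (auto simp: dist_norm norm_minus_commute)
  qed
  have L: "L holomorphic_on {p. Re p > 0}"
    unfolding holomorphic_on_def
  proof
    fix w assume "w \<in> {p. Re p > 0}"
    then obtain t where t: "t > 0" "w \<in> ball (complex_of_real t) t"
      using cover by blast
    have "L holomorphic_on ball (of_real t) t"
      by (rule power_series_holomorphic[OF ps[OF t(1)]])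
    then have "L field_differentiable at w"
      using t(2) by (intro holomorphic_on_imp_differentiable_at[OF _ open_ball])
    then show "L field_differentiable at w within {p. Re p > 0}"
      by (rule field_differentiable_at_within)
  qed
  \<comment> \<open>Identity theorem: both functions are holomorphic on the half-plane and agree on
    the real ray beyond \<open>x\<close>, which accumulates at \<open>x + 1\<close>.\<close>
  have LG: "L w = G w" if "Re w > 0" for w
  proof -
    have "L w - G w = 0"
    proof (rule analytic_continuation[where f = "\<lambda>w. L w - G w" and S = "{p. Re p > 0}"
          and U = "complex_of_real ` {x<..}" and \<xi> = "of_real (x + 1)"])
      show "(\<lambda>w. L w - G w) holomorphic_on {p. Re p > 0}"
        using L G by (intro holomorphic_intros)
      show "connected {p. Re p > 0}" by (intro convex_connected convex_halfspace_Re_gt)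
      show "complex_of_real (x + 1) islimpt complex_of_real ` {x<..}"
        unfolding islimpt_approachable
      proof (intro allI impI)
        fix e :: real assume "e > 0"
        then show "\<exists>w\<in>complex_of_real ` {x<..}. w \<noteq> of_real (x + 1) \<and> dist w (of_real (x + 1)) < e"
          by (intro bexI[of _ "of_real (x + 1 + e / 2)"])
             (auto simp: dist_norm norm_divide simp flip: of_real_diff of_real_add of_real_divide)
      qed
      fix w assume "w \<in> complex_of_real ` {x<..}"
      then obtain t where t: "t > x" "w = of_real t" by auto
      have "(\<lambda>c. exp (- t * c) * g c) integrable_on {0..}"
      proof (rule measurable_bounded_by_integrable_imp_integrable[OF _ int[of t]])
        show "(\<lambda>c. exp (- t * c) * g c) \<in> borel_measurable (lebesgue_on {0..})"
          by (intro continuous_imp_measurable_on_sets_lebesgue continuous_intros cont) auto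
      qed (use t x in \<open>auto simp: abs_mult\<close>)
      from has_integral_of_real[OF integrable_integral[OF this], where ?'b = complex]
      have "L w = of_real (T t)"
        unfolding L_def t(2) eq(1)[OF t(1)]
        by (intro integral_unique) (simp add: exp_of_real flip: of_real_mult of_real_minus of_real_exp)
      then show "L w - G w = 0" using t eq(2) by simp
    qed (use op x that in auto)
    then show ?thesis by simp
  qed
  have "complex_of_real ((-1) ^ k / fact k * integral {0..} (\<lambda>c. exp (- p * c) * c ^ k * g c)) =
           (deriv ^^ k) L (of_real p) / fact k"
    by (rule power_series_coeff_unique[OF p ps[OF p]]) auto
  also have "(deriv ^^ k) L (of_real p) = (deriv ^^ k) G (of_real p)"
    using p by (intro higher_deriv_transform_within_open[OF L G op]) (auto intro: LG)
  finally show ?thesis .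
qed

subsection \<open>The Laplace transform of the Bessel function\<close>

text \<open>The extra \<open>c powr \<nu>\<close> beside the first Bessel function is the power
  split off from the second one, whose remaining factor \<open>bessel_clifford (2 * \<nu>) c\<close>
  is expanded in integer powers of \<open>c\<close>.\<close>

definition bessel_kernel :: "real \<Rightarrow> real \<Rightarrow> real \<Rightarrow> real" where
  "bessel_kernel \<nu> x c = (x / 2) powr \<nu> * c powr (2 * \<nu>) * bessel_clifford \<nu> ((c * x / 2)\<^sup>2)"

text \<open>The Laplace transform \<open>(2 * x) powr \<nu> * Gamma (\<nu> + 1/2) / sqrt pi * (p\<^sup>2 + x\<^sup>2) powr (- \<nu> - 1/2)\<close>
  of \<open>bessel_kernel \<nu> x\<close>, that is of \<open>c powr \<nu> * J\<^sub>\<nu> (c * x)\<close>; with \<open>x\<^sup>2\<close> factored out the complex power is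
  the one of the binomial series at \<open>p = 0\<close>.\<close>

definition bessel_laplace :: "real \<Rightarrow> real \<Rightarrow> complex \<Rightarrow> complex" where
  "bessel_laplace \<nu> x p = of_real ((x / 2) powr \<nu> * (2 powr (2 * \<nu>) * Gamma (\<nu> + 1/2) / sqrt pi) *
     x powr (- 2 * \<nu> - 1)) * (1 + (p / of_real x)\<^sup>2) powr (- of_real (\<nu> + 1/2))"

lemma Gamma_legendre_duplication_real:
  fixes s :: real
  assumes "s > 0"
  shows "Gamma s * Gamma (s + 1/2) = 2 powr (1 - 2 * s) * sqrt pi * Gamma (2 * s)"
proof -
  have "complex_of_real t \<notin> \<int>\<^sub>\<le>\<^sub>0" if "t > 0" for t
    using that by (auto simp: of_real_in_nonpos_Ints_iff)
  from Gamma_legendre_duplication[OF this[OF assms]] this[of "s + 1/2"] assms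
  have "complex_of_real (Gamma s * Gamma (s + 1/2)) =
    exp ((1 - 2 * of_real s) * of_real (ln 2)) * of_real (sqrt pi) * Gamma (2 * of_real s)"
    by (simp flip: Gamma_complex_of_real)
  also have "exp ((1 - 2 * complex_of_real s) * of_real (ln 2)) = of_real (2 powr (1 - 2 * s))"
    by (simp add: powr_def flip: exp_of_real)
  also have "Gamma (2 * complex_of_real s) = of_real (Gamma (2 * s))"
    by (simp flip: Gamma_complex_of_real)
  finally show ?thesis
    by (simp only: of_real_mult[symmetric] of_real_eq_iff)
qed

text \<open>Duplication at \<open>\<nu> + j + 1/2\<close> turns the quotient of
  \<open>Gamma (2 * \<nu> + 2 * j + 1)\<close> by \<open>Gamma (\<nu> + j + 1)\<close> into
  \<open>Gamma (\<nu> + j + 1/2)\<close>. Divided by \<open>Gamma (\<nu> + 1/2)\<close> this is a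
  Pochhammer symbol, hence a binomial coefficient up to sign and factorial.\<close>

lemma bessel_laplace_coeff:
  fixes \<nu> :: real
  assumes "\<nu> > 0"
  shows "(-1) ^ j / fact j * rGamma (\<nu> + of_nat j + 1) * Gamma (2 * \<nu> + 2 * of_nat j + 1) =
           2 powr (2 * \<nu>) * Gamma (\<nu> + 1/2) / sqrt pi * 4 ^ j * (- (\<nu> + 1/2) gchoose j)"
proof -
  define G1 where "G1 = Gamma (\<nu> + j + 1/2)"
  define G2 where "G2 = Gamma (\<nu> + j + 1)"
  define G3 where "G3 = Gamma (2 * \<nu> + 2 * j + 1)"
  define P where "P = 2 powr (2 * \<nu>)"
  have "G1 * G2 = 2 powr (- 2 * \<nu> - 2 * j) * sqrt pi * G3"
    using Gamma_legendre_duplication_real[of "\<nu> + j + 1/2"] assms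
    by (simp add: G1_def G2_def G3_def algebra_simps)
  also have "2 powr (- 2 * \<nu> - 2 * j) = inverse (P * 4 ^ j)"
    by (simp add: P_def powr_diff powr_minus powr_realpow[symmetric] powr_powr[symmetric] divide_inverse)
  finally have "G1 * G2 = inverse (P * 4 ^ j) * sqrt pi * G3" .
  moreover have "P > 0" by (simp add: P_def)
  moreover have "G2 > 0"
    using assms unfolding G2_def by (intro Gamma_real_pos) auto
  ultimately have "inverse G2 * G3 = P * 4 ^ j * G1 / sqrt pi"
    by (simp add: field_simps)
  then have rG: "rGamma (\<nu> + j + 1) * Gamma (2 * \<nu> + 2 * j + 1) =
      2 powr (2 * \<nu>) * 4 ^ j * Gamma (\<nu> + j + 1/2) / sqrt pi"
    by (simp add: rGamma_inverse_Gamma G1_def G2_def G3_def P_def)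
  have gb: "(- (\<nu> + 1/2) gchoose j) = (-1) ^ j / fact j * (Gamma (\<nu> + j + 1/2) / Gamma (\<nu> + 1/2))"
  proof -
    have "\<nu> + 1/2 \<notin> \<int>\<^sub>\<le>\<^sub>0"
      using assms nonpos_Ints_nonpos[of "\<nu> + 1/2"] by force
    from pochhammer_Gamma[OF this, of j] show ?thesis
      by (simp add: gbinomial_pochhammer add_ac)
  qed
  have "Gamma (\<nu> + 1/2) > 0"
    using assms by (intro Gamma_real_pos) auto
  then have "Gamma (\<nu> + 1/2) \<noteq> 0"
    by (rule less_imp_neq[THEN not_sym])
  moreover have "(-1) ^ j / fact j * rGamma (\<nu> + j + 1) * Gamma (2 * \<nu> + 2 * j + 1) =
      (-1) ^ j / fact j * (rGamma (\<nu> + j + 1) * Gamma (2 * \<nu> + 2 * j + 1))"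
    by (simp only: mult.assoc)
  ultimately show ?thesis
    unfolding gb rG by (simp add: mult_ac)
qed

lemma bessel_kernel_bound:
  assumes "\<nu> > 0"
  obtains B where "B \<ge> 0" "\<And>c. c \<ge> 0 \<Longrightarrow> \<bar>bessel_kernel \<nu> x c\<bar> \<le> B * c powr (2 * \<nu>)"
proof -
  obtain C where C: "C \<ge> 0"
    "\<And>w. w \<ge> 0 \<Longrightarrow> \<bar>bessel_clifford \<nu> w\<bar> \<le> C * (1 + w) powr (- (\<nu> / 2 + 1/4))"
    using bessel_clifford_bound[of \<nu>] assms by auto
  have "\<bar>bessel_clifford \<nu> w\<bar> \<le> C" if "w \<ge> 0" for w
  proof -
    have "(1 + w) powr (- (\<nu> / 2 + 1/4)) \<le> (1 + w) powr 0"
      using that assms by (intro powr_mono) auto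
    then show ?thesis
      using C(2)[OF that] mult_left_mono[OF _ C(1)] that by fastforce
  qed
  then have "\<bar>bessel_kernel \<nu> x c\<bar> \<le> (x / 2) powr \<nu> * C * c powr (2 * \<nu>)" for c
    using mult_left_mono[of "\<bar>bessel_clifford \<nu> ((c * x / 2)\<^sup>2)\<bar>" C "(x / 2) powr \<nu> * c powr (2 * \<nu>)"]
    by (simp add: bessel_kernel_def abs_mult mult_ac)
  with C(1) show ?thesis by (intro that[of "(x / 2) powr \<nu> * C"]) auto
qed

lemma continuous_on_bessel_kernel:
  assumes "\<nu> > 0"
  shows "continuous_on {0..} (bessel_kernel \<nu> x)"
proof -
  have "continuous_on {0..} (\<lambda>c::real. c powr (2 * \<nu>))"
    using assms by (intro continuous_on_powr') auto
  then show ?thesis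
    unfolding bessel_kernel_def[abs_def] using assms
    by (auto intro!: continuous_on_mult continuous_on_const
        continuous_on_bessel_clifford continuous_on_power continuous_on_divide continuous_on_id)
qed

lemma integrable_bessel_kernel:
  assumes "\<nu> > 0" "s > 0"
  shows "(\<lambda>c. exp (- s * c) * \<bar>bessel_kernel \<nu> x c\<bar>) integrable_on {0..}"
proof -
  obtain B where B: "B \<ge> 0" "\<And>c. c \<ge> 0 \<Longrightarrow> \<bar>bessel_kernel \<nu> x c\<bar> \<le> B * c powr (2 * \<nu>)"
    using bessel_kernel_bound[OF assms(1), of x] by blast
  show ?thesis
  proof (rule measurable_bounded_by_integrable_imp_integrable)
    show "(\<lambda>c. exp (- s * c) * \<bar>bessel_kernel \<nu> x c\<bar>) \<in> borel_measurable (lebesgue_on {0..})"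
      by (intro continuous_imp_measurable_on_sets_lebesgue continuous_intros
          continuous_on_bessel_kernel assms) auto
    show "(\<lambda>c. B * (exp (- s * c) * c powr (2 * \<nu>))) integrable_on {0..}"
      using has_integral_integrable[OF laplace_gamma_integral[of "2 * \<nu>" s]] assms
      by (intro integrable_on_mult_right) auto
    fix c :: real assume "c \<in> {0..}"
    then have "exp (- s * c) * \<bar>bessel_kernel \<nu> x c\<bar> \<le> exp (- s * c) * (B * c powr (2 * \<nu>))"
      by (intro mult_left_mono B) auto
    then show "norm (exp (- s * c) * \<bar>bessel_kernel \<nu> x c\<bar>) \<le> B * (exp (- s * c) * c powr (2 * \<nu>))"
      by (simp add: mult_ac)
  qed auto
qed

text \<open>For \<open>p > x\<close> termwise integration is legitimate, since the series of
  absolute values grows at most like \<open>exp (x * c)\<close>, and the binomial series in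
  \<open>(x / p)^2\<close> converges. \<open>laplace_moments_analytic\<close> extends the formula to
  all \<open>p > 0\<close>.\<close>

lemma laplace_bessel_kernel:
  fixes p :: real
  assumes "\<nu> > 0" "x > 0" "p > x"
  shows "integral {0..} (\<lambda>c. exp (- p * c) * bessel_kernel \<nu> x c) =
    (x / 2) powr \<nu> * (2 powr (2 * \<nu>) * Gamma (\<nu> + 1/2) / sqrt pi) *
     x powr (- 2 * \<nu> - 1) * (1 + (p / x)\<^sup>2) powr (- (\<nu> + 1/2))" (is "_ = ?rhs")
proof -
  let ?H = "2 powr (2 * \<nu>) * Gamma (\<nu> + 1/2) / sqrt pi"
  let ?a = "\<nu> + 1/2"
  define a where "a = (\<lambda>k. (-1) ^ k / fact k * rGamma (\<nu> + of_nat k + 1))"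
  define h where "h = (\<lambda>k c. (x / 2) powr \<nu> * a k * (x / 2) ^ (2 * k) * (exp (- p * c) * c powr (2 * \<nu> + 2 * real k)))"
  have p: "p > 0" using assms by simp
  have pw: "c powr (2 * \<nu> + 2 * real k) = c powr (2 * \<nu>) * c ^ (2 * k)" if "c \<ge> 0" for c :: real and k
    using that assms powr_realpow[of c "2 * k"] by (cases "c = 0") (simp_all add: powr_add)
  have h_int: "(h k has_integral (x / 2) powr \<nu> * a k * (x / 2) ^ (2 * k) *
      (Gamma (2 * \<nu> + 2 * real k + 1) / p powr (2 * \<nu> + 2 * real k + 1))) {0..}" for k
    unfolding h_def using assms by (intro has_integral_mult_right laplace_gamma_integral) auto
  have h_cont: "continuous_on {0..} (h k)" for k
    unfolding h_def using assms
    by (intro continuous_on_mult continuous_on_const continuous_on_powr' continuous_on_exp continuous_on_id)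
       auto
  define D where "D = (\<lambda>c. (x / 2) powr \<nu> * rGamma (\<nu> + 1) * (exp (- (p - x) * c) * c powr (2 * \<nu>)))"
  have D: "D integrable_on {0..}"
    unfolding D_def using assms
    by (intro integrable_on_mult_right has_integral_integrable[OF laplace_gamma_integral]) auto
  have rG: "0 < rGamma (\<nu> + 1)" using rGamma_shift_le(1)[of \<nu> 0] assms by simp
  have le: "(\<Sum>k<n. norm (h k c)) \<le> D c" if c: "c \<in> {0..}" for n c
  proof -
    define y where "y = c * x / 2"
    have y: "y \<ge> 0" using c assms by (simp add: y_def)
    \<comment> \<open>Each of the two factorials in \<open>a k\<close> takes one factor
      \<open>y ^ k\<close>: one is bounded by \<open>exp y\<close> at once, the other sums to a
      second \<open>exp y\<close>. Together they give \<open>exp (x * c)\<close>.\<close>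
    have "\<bar>a k\<bar> * y ^ (2 * k) \<le> rGamma (\<nu> + 1) * exp y * (y ^ k / fact k)" for k
    proof -
      have "\<bar>a k\<bar> \<le> rGamma (\<nu> + 1) / fact k / fact k"
        using divide_right_mono[OF rGamma_shift_le(2)[of \<nu> k], of "fact k"]
          rGamma_shift_le(1)[of \<nu> k] assms
        by (simp add: a_def abs_mult)
      then have "\<bar>a k\<bar> * y ^ (2 * k) \<le> rGamma (\<nu> + 1) / fact k / fact k * y ^ (2 * k)"
        using y by (intro mult_right_mono) auto
      also have "\<dots> = rGamma (\<nu> + 1) * (y ^ k / fact k) * (y ^ k / fact k)"
        by (simp add: mult_2 power_add)
      also have "y ^ k / fact k \<le> exp y"
        using exp_series_partial_le[OF y, of "Suc k"] y
          sum_nonneg[of "{..<k}" "\<lambda>k. y ^ k / fact k"] by simp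
      then have "rGamma (\<nu> + 1) * (y ^ k / fact k) * (y ^ k / fact k) \<le>
          rGamma (\<nu> + 1) * exp y * (y ^ k / fact k)"
        using rG y by (intro mult_right_mono mult_left_mono) auto
      finally show ?thesis .
    qed
    then have "(\<Sum>k<n. \<bar>a k\<bar> * y ^ (2 * k)) \<le> rGamma (\<nu> + 1) * exp y * (\<Sum>k<n. y ^ k / fact k)"
      unfolding sum_distrib_left by (intro sum_mono)
    also have "\<dots> \<le> rGamma (\<nu> + 1) * exp y * exp y"
      using rG y by (intro mult_left_mono exp_series_partial_le) auto
    also have "\<dots> = rGamma (\<nu> + 1) * exp (x * c)"
      by (simp add: y_def mult_exp_exp mult_ac)
    finally have S: "(\<Sum>k<n. \<bar>a k\<bar> * y ^ (2 * k)) \<le> rGamma (\<nu> + 1) * exp (x * c)" .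
    have "norm (h k c) = (x / 2) powr \<nu> * c powr (2 * \<nu>) * exp (- p * c) * (\<bar>a k\<bar> * y ^ (2 * k))" for k
      using c assms by (simp add: h_def y_def pw abs_mult power_mult_distrib power_divide)
    then have "(\<Sum>k<n. norm (h k c)) =
        (x / 2) powr \<nu> * c powr (2 * \<nu>) * exp (- p * c) * (\<Sum>k<n. \<bar>a k\<bar> * y ^ (2 * k))"
      by (simp add: sum_distrib_left)
    also have "\<dots> \<le> (x / 2) powr \<nu> * c powr (2 * \<nu>) * exp (- p * c) * (rGamma (\<nu> + 1) * exp (x * c))"
      by (intro mult_left_mono S) auto
    also have "\<dots> = (x / 2) powr \<nu> * rGamma (\<nu> + 1) * ((exp (- p * c) * exp (x * c)) * c powr (2 * \<nu>))"
      by (simp only: mult_ac)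
    also have "exp (- p * c) * exp (x * c) = exp (- (p - x) * c)"
      by (simp add: mult_exp_exp algebra_simps)
    finally show ?thesis by (simp add: D_def)
  qed
  have sums: "(\<lambda>k. h k c) sums (exp (- p * c) * bessel_kernel \<nu> x c)" if c: "c \<in> {0..}" for c
  proof -
    have "(\<lambda>k. exp (- p * c) * ((x / 2) powr \<nu> * c powr (2 * \<nu>) * (a k * ((c * x / 2)\<^sup>2) ^ k))) sums
      (exp (- p * c) * bessel_kernel \<nu> x c)"
      unfolding bessel_kernel_def a_def using assms by (intro sums_mult bessel_clifford_sums) auto
    also have "(\<lambda>k. exp (- p * c) * ((x / 2) powr \<nu> * c powr (2 * \<nu>) * (a k * ((c * x / 2)\<^sup>2) ^ k))) =
      (\<lambda>k. h k c)"
    proof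
      fix k
      have "((c * x / 2)\<^sup>2) ^ k = (x / 2) ^ (2 * k) * c ^ (2 * k)"
        by (simp add: power_mult_distrib power_divide power_mult)
      moreover have "c \<ge> 0" using c by simp
      ultimately show "exp (- p * c) * ((x / 2) powr \<nu> * c powr (2 * \<nu>) * (a k * ((c * x / 2)\<^sup>2) ^ k)) = h k c"
        unfolding h_def by (subst pw) (simp_all only: mult_ac)
    qed
    finally show ?thesis .
  qed
  have lb: "({0..} :: real set) \<in> sets lebesgue" by simp
  have S1: "(\<lambda>k. integral {0..} (h k)) sums integral {0..} (\<lambda>c. exp (- p * c) * bessel_kernel \<nu> x c)"
    by (rule integral_sums_dominated(3)[OF h_cont lb D le sums])
  have h_eq: "integral {0..} (h k) =
      (x / 2) powr \<nu> * ?H * p powr (- 2 * \<nu> - 1) * ((- ?a gchoose k) * ((x / p)\<^sup>2) ^ k)" for k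
  proof -
    have "integral {0..} (h k) = (x / 2) powr \<nu> * (x / 2) ^ (2 * k) *
      (a k * Gamma (2 * \<nu> + 2 * real k + 1)) / p powr (2 * \<nu> + 2 * real k + 1)"
      using integral_unique[OF h_int[of k]] by simp
    also have "a k * Gamma (2 * \<nu> + 2 * real k + 1) = ?H * 4 ^ k * (- ?a gchoose k)"
      using bessel_laplace_coeff[OF assms(1), of k] by (simp add: a_def)
    also have "p powr (2 * \<nu> + 2 * real k + 1) = p ^ (2 * k) / p powr (- 2 * \<nu> - 1)"
    proof -
      have "p powr (- 2 * \<nu> - 1) = inverse (p powr (2 * \<nu> + 1))"
        by (simp flip: powr_minus)
      then show ?thesis
        using p powr_realpow[of p "2 * k"] powr_add[of p "2 * \<nu> + 1" "2 * real k"]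
        by (simp add: add_ac divide_inverse mult_ac)
    qed
    also have "(x / 2) ^ (2 * k) = x ^ (2 * k) / 4 ^ k"
      by (simp add: power_divide power_mult)
    finally have "integral {0..} (h k) = (x / 2) powr \<nu> * (x ^ (2 * k) / 4 ^ k) *
      (?H * 4 ^ k * (- ?a gchoose k)) / (p ^ (2 * k) / p powr (- 2 * \<nu> - 1))" .
    also have "\<dots> = (x / 2) powr \<nu> * ?H * p powr (- 2 * \<nu> - 1) *
      ((- ?a gchoose k) * (x ^ (2 * k) / p ^ (2 * k)))"
    proof -
      have "X * (Y / 4 ^ k) * (H * 4 ^ k * b) / (q / P) = X * H * P * (b * (Y / q))"
        for X Y H b q P :: real by simp
      then show ?thesis .
    qed
    also have "x ^ (2 * k) / p ^ (2 * k) = ((x / p)\<^sup>2) ^ k"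
      by (simp add: power_divide power_mult)
    finally show ?thesis .
  qed
  have S2: "(\<lambda>k. (x / 2) powr \<nu> * ?H * p powr (- 2 * \<nu> - 1) * ((- ?a gchoose k) * ((x / p)\<^sup>2) ^ k))
    sums ((x / 2) powr \<nu> * ?H * p powr (- 2 * \<nu> - 1) * (1 + (x / p)\<^sup>2) powr (- ?a))"
    using assms p by (intro sums_mult gen_binomial_real)
       (simp add: power_divide power_strict_mono)
  have "integral {0..} (\<lambda>c. exp (- p * c) * bessel_kernel \<nu> x c) =
    (x / 2) powr \<nu> * ?H * p powr (- 2 * \<nu> - 1) * (1 + (x / p)\<^sup>2) powr (- ?a)"
    using S1 S2 unfolding h_eq by (rule sums_unique2)
  also have "\<dots> = (x / 2) powr \<nu> * ?H * (p powr (- 2 * \<nu> - 1) * (1 + (x / p)\<^sup>2) powr (- ?a))"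
    by (simp only: mult.assoc)
  \<comment> \<open>Both sides equal \<open>(p^2 + x^2) powr (- (\<nu> + 1/2))\<close>. Factoring
    out \<open>x^2\<close> instead of \<open>p^2\<close> gives the form that is regular at
    \<open>p = 0\<close>.\<close>
  also have "p powr (- 2 * \<nu> - 1) * (1 + (x / p)\<^sup>2) powr (- ?a) = x powr (- 2 * \<nu> - 1) * (1 + (p / x)\<^sup>2) powr (- ?a)"
  proof -
    have *: "t powr (- 2 * \<nu> - 1) = (t\<^sup>2) powr (- ?a)" if "t > 0" for t :: real
      using powr_powr[of t 2 "- ?a"] that by simp
    have E: "p\<^sup>2 * (1 + (x / p)\<^sup>2) = x\<^sup>2 * (1 + (p / x)\<^sup>2)"
      using assms p by (simp add: power_divide distrib_left)
    show ?thesis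
      unfolding *[OF p] *[OF assms(2)] powr_mult[symmetric] E ..
  qed
  finally show ?thesis by (simp only: mult.assoc)
qed

text \<open>For \<open>q = p / x\<close>, a nonpositive value of \<open>1 + q^2\<close> forces
  \<open>q\<close> to be purely imaginary of modulus at least 1. The union of half-plane and disc
  joins the Laplace transform for \<open>p > 0\<close> to its expansion at 0.\<close>

lemma bessel_laplace_branch:
  assumes "x > 0" "Re p > 0 \<or> p \<in> ball 0 x"
  shows "1 + (p / complex_of_real x)\<^sup>2 \<notin> \<real>\<^sub>\<le>\<^sub>0"
proof
  define q where "q = p / complex_of_real x"
  assume "1 + (p / complex_of_real x)\<^sup>2 \<in> \<real>\<^sub>\<le>\<^sub>0"
  then have q: "1 + (Re q)\<^sup>2 - (Im q)\<^sup>2 \<le> 0" "Re q * Im q = 0"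
    by (auto simp: complex_nonpos_Reals_iff q_def[symmetric] power2_eq_square)
  from assms(2) show False
  proof
    assume "Re p > 0"
    then have "Re q > 0" using assms by (simp add: q_def)
    then have "Im q = 0" using q(2) by simp
    then show False using q(1) by (simp add: add_nonneg_pos not_le) (smt (verit) zero_le_power2)
  next
    assume "p \<in> ball 0 x"
    then have "norm q < 1" using assms by (simp add: q_def norm_divide)
    then have "(Im q)\<^sup>2 < 1"
      using abs_Im_le_cmod[of q] by (simp add: abs_square_less_1)
    then show False using q(1) by (smt (verit) zero_le_power2)
  qed
qed

lemma holomorphic_bessel_laplace:
  assumes "x > 0"
  shows "bessel_laplace \<nu> x holomorphic_on {p. Re p > 0} \<union> ball 0 x"
  unfolding bessel_laplace_def[abs_def] using bessel_laplace_branch[OF assms] assms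
  by (intro holomorphic_intros) auto

text \<open>The binomial series in \<open>(p / x)^2\<close> yields the even coefficients; reindexing
  by \<open>2 * j\<close> fills the odd places with zeros.\<close>

lemma bessel_laplace_taylor:
  assumes "x > 0"
  shows "(deriv ^^ k) (bessel_laplace \<nu> x) 0 / fact k =
    of_real (if even k
      then (x / 2) powr \<nu> * (2 powr (2 * \<nu>) * Gamma (\<nu> + 1/2) / sqrt pi) *
        x powr (- 2 * \<nu> - 1) * (- (\<nu> + 1/2) gchoose (k div 2)) / x ^ k
      else 0)"
proof -
  define N where "N = (x / 2) powr \<nu> * (2 powr (2 * \<nu>) * Gamma (\<nu> + 1/2) / sqrt pi) * x powr (- 2 * \<nu> - 1)"
  define b where "b = (\<lambda>k. complex_of_real (if even k
      then N * (- (\<nu> + 1/2) gchoose (k div 2)) / x ^ k else 0))"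
  have gb: "(- complex_of_real (\<nu> + 1/2) gchoose j) = of_real (- (\<nu> + 1/2) gchoose j)" for j
    by (simp add: gbinomial_prod_rev)
  have "b k = (deriv ^^ k) (bessel_laplace \<nu> x) 0 / fact k"
  proof (rule power_series_coeff_unique[OF assms])
    fix p :: complex assume "p \<in> ball 0 x"
    then have "norm (p / of_real x) < 1" using assms by (simp add: norm_divide)
    then have "norm ((p / of_real x)\<^sup>2) < 1"
      by (simp add: norm_power abs_square_less_1)
    from sums_mult[OF gen_binomial_complex[OF this], of "of_real N" "- of_real (\<nu> + 1/2)"]
    have "(\<lambda>j. of_real N * ((- of_real (\<nu> + 1/2) gchoose j) * ((p / of_real x)\<^sup>2) ^ j)) sums bessel_laplace \<nu> x p"
      unfolding bessel_laplace_def N_def .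
    also have "(\<lambda>j. of_real N * ((- of_real (\<nu> + 1/2) gchoose j) * ((p / of_real x)\<^sup>2) ^ j)) =
      (\<lambda>j. b (2 * j) * (p - 0) ^ (2 * j))"
      unfolding gb by (simp add: b_def fun_eq_iff power_divide power_mult)
    finally show "(\<lambda>k. b k * (p - 0) ^ k) sums bessel_laplace \<nu> x p"
      by (subst (asm) sums_mono_reindex[where g = "\<lambda>j. 2 * j" and f = "\<lambda>k. b k * (p - 0) ^ k"])
         (auto simp: strict_mono_def b_def elim!: evenE)
  qed
  then show ?thesis unfolding b_def N_def by (rule sym)
qed

text \<open>Expand the second Bessel factor in powers of \<open>c\<close>. Its coefficient carries
  \<open>(-1) ^ k / fact k\<close>, exactly what turns the \<open>k\<close>-th moment of the damped
  kernel into a Taylor coefficient of its Laplace transform at \<open>p\<close>.\<close>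

lemma laplace_bessel_product_sums:
  assumes "\<nu> > 0" "x > 0" "p > 0"
  shows "(\<lambda>k. of_real (rGamma (2 * \<nu> + of_nat k + 1)) *
             ((deriv ^^ k) (bessel_laplace \<nu> x) (of_real p) / fact k)) sums
         complex_of_real (integral {0..} (\<lambda>c. exp (- p * c) * (bessel_kernel \<nu> x c * bessel_clifford (2 * \<nu>) c)))"
proof -
  let ?g = "bessel_kernel \<nu> x"
  define a where "a = (\<lambda>k. (-1) ^ k / fact k * rGamma (2 * \<nu> + of_nat k + 1))"
  define h where "h = (\<lambda>k c. a k * (exp (- p * c) * c ^ k * ?g c))"
  define D where "D = (\<lambda>c. rGamma (2 * \<nu> + 1) * exp (2 / p) * (exp (- (p / 2) * c) * \<bar>?g c\<bar>))"
  have rG: "0 < rGamma (2 * \<nu> + 1)" using rGamma_shift_le(1)[of "2 * \<nu>" 0] assms by simp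
  have h_cont: "continuous_on {0..} (h k)" for k
    unfolding h_def by (intro continuous_intros continuous_on_bessel_kernel assms)
  have D: "D integrable_on {0..}"
    unfolding D_def using assms by (intro integrable_on_mult_right integrable_bessel_kernel) auto
  have le: "(\<Sum>k<n. norm (h k c)) \<le> D c" if c: "c \<in> {0..}" for n c
  proof -
    \<comment> \<open>One factorial is spent on
      \<open>1 / fact k \<le> exp (2 / p) * (p / 2) ^ k\<close>. The other then sums to
      \<open>exp (p / 2 * c)\<close>, so half of the damping survives.\<close>
    have "\<bar>a k\<bar> * c ^ k \<le> rGamma (2 * \<nu> + 1) * exp (2 / p) * ((p / 2 * c) ^ k / fact k)" for k
    proof -
      have "(2 / p) ^ k / fact k \<le> exp (2 / p)"
        using exp_series_partial_le[of "2 / p" "Suc k"] assms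
          sum_nonneg[of "{..<k}" "\<lambda>k. (2 / p) ^ k / fact k"] by simp
      then have k: "1 / fact k \<le> exp (2 / p) * (p / 2) ^ k"
        using assms by (simp add: field_simps)
      have "\<bar>a k\<bar> \<le> rGamma (2 * \<nu> + 1) / fact k / fact k"
        using divide_right_mono[OF rGamma_shift_le(2)[of "2 * \<nu>" k], of "fact k"]
          rGamma_shift_le(1)[of "2 * \<nu>" k] assms
        by (simp add: a_def abs_mult)
      then have "\<bar>a k\<bar> * c ^ k \<le> rGamma (2 * \<nu> + 1) / fact k / fact k * c ^ k"
        using c by (intro mult_right_mono) auto
      also have "\<dots> = rGamma (2 * \<nu> + 1) * (1 / fact k) * (c ^ k / fact k)" by simp
      also have "\<dots> \<le> rGamma (2 * \<nu> + 1) * (exp (2 / p) * (p / 2) ^ k) * (c ^ k / fact k)"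
        using rG c by (intro mult_right_mono mult_left_mono k) auto
      also have "\<dots> = rGamma (2 * \<nu> + 1) * exp (2 / p) * ((p / 2 * c) ^ k / fact k)"
        unfolding power_mult_distrib[of "p / 2" c] by simp
      finally show ?thesis .
    qed
    then have "(\<Sum>k<n. \<bar>a k\<bar> * c ^ k) \<le> rGamma (2 * \<nu> + 1) * exp (2 / p) * (\<Sum>k<n. (p / 2 * c) ^ k / fact k)"
      unfolding sum_distrib_left by (intro sum_mono)
    also have "\<dots> \<le> rGamma (2 * \<nu> + 1) * exp (2 / p) * exp (p / 2 * c)"
      using rG c assms by (intro mult_left_mono exp_series_partial_le) auto
    finally have S: "(\<Sum>k<n. \<bar>a k\<bar> * c ^ k) \<le> rGamma (2 * \<nu> + 1) * exp (2 / p) * exp (p / 2 * c)" .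
    have "(\<Sum>k<n. norm (h k c)) = exp (- p * c) * \<bar>?g c\<bar> * (\<Sum>k<n. \<bar>a k\<bar> * c ^ k)"
      using c by (simp add: h_def abs_mult sum_distrib_left mult_ac)
    also have "\<dots> \<le> exp (- p * c) * \<bar>?g c\<bar> * (rGamma (2 * \<nu> + 1) * exp (2 / p) * exp (p / 2 * c))"
      by (intro mult_left_mono S) auto
    also have "\<dots> = rGamma (2 * \<nu> + 1) * exp (2 / p) * ((exp (- p * c) * exp (p / 2 * c)) * \<bar>?g c\<bar>)"
      by (simp only: mult_ac)
    also have "exp (- p * c) * exp (p / 2 * c) = exp (- (p / 2) * c)"
      by (simp add: mult_exp_exp)
    finally show ?thesis by (simp add: D_def)
  qed
  have sums: "(\<lambda>k. h k c) sums (exp (- p * c) * (?g c * bessel_clifford (2 * \<nu>) c))" for c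
  proof -
    have "(\<lambda>k. exp (- p * c) * (?g c * (a k * c ^ k))) sums (exp (- p * c) * (?g c * bessel_clifford (2 * \<nu>) c))"
      unfolding a_def using assms by (intro sums_mult bessel_clifford_sums) auto
    then show ?thesis by (simp add: h_def mult_ac)
  qed
  have lb: "({0..} :: real set) \<in> sets lebesgue" by simp
  have "(\<lambda>k. integral {0..} (h k)) sums integral {0..} (\<lambda>c. exp (- p * c) * (?g c * bessel_clifford (2 * \<nu>) c))"
    by (rule integral_sums_dominated(3)[OF h_cont lb D le sums])
  then have "(\<lambda>k. complex_of_real (integral {0..} (h k))) sums
    of_real (integral {0..} (\<lambda>c. exp (- p * c) * (?g c * bessel_clifford (2 * \<nu>) c)))"
    by (rule sums_of_real)
  moreover have "complex_of_real (integral {0..} (h k)) = of_real (rGamma (2 * \<nu> + of_nat k + 1)) *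
             ((deriv ^^ k) (bessel_laplace \<nu> x) (of_real p) / fact k)" for k
  proof -
    have G: "bessel_laplace \<nu> x holomorphic_on {p. Re p > 0}"
      using holomorphic_bessel_laplace[OF assms(2)] by (rule holomorphic_on_subset) auto
    have BL: "bessel_laplace \<nu> x (of_real t) = of_real ((x / 2) powr \<nu> * (2 powr (2 * \<nu>) * Gamma (\<nu> + 1/2) / sqrt pi) *
     x powr (- 2 * \<nu> - 1) * (1 + (t / x)\<^sup>2) powr (- (\<nu> + 1/2)))" for t
    proof -
      have "(1 + (complex_of_real t / of_real x)\<^sup>2) powr (- of_real (\<nu> + 1/2)) =
          complex_of_real (1 + (t / x)\<^sup>2) powr (of_real (- (\<nu> + 1/2)))" by simp
      also have "\<dots> = of_real ((1 + (t / x)\<^sup>2) powr (- (\<nu> + 1/2)))"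
        by (rule powr_of_real) simp
      finally show ?thesis by (simp only: bessel_laplace_def of_real_mult)
    qed
    have "complex_of_real ((-1) ^ k / fact k * integral {0..} (\<lambda>c. exp (- p * c) * c ^ k * ?g c)) =
        (deriv ^^ k) (bessel_laplace \<nu> x) (of_real p) / fact k"
      by (rule laplace_moments_analytic[OF continuous_on_bessel_kernel[OF assms(1)]
          integrable_bessel_kernel[OF assms(1)] G laplace_bessel_kernel[OF assms(1,2)] BL])
         (use assms in auto)
    moreover have "integral {0..} (h k) = rGamma (2 * \<nu> + of_nat k + 1) *
        ((-1) ^ k / fact k * integral {0..} (\<lambda>c. exp (- p * c) * c ^ k * ?g c))"
      unfolding h_def a_def by (subst integral_mult_right) (simp only: mult_ac)
    ultimately show ?thesis by (simp only: of_real_mult)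
  qed
  ultimately show ?thesis by simp
qed

text \<open>The coefficient identity is used backwards:
  \<open>rGamma (2 * \<nu> + 2 * j + 1)\<close> cancels the \<open>Gamma\<close> factor, and
  \<open>4 ^ j\<close> joins \<open>x ^ (2 * j)\<close> to form powers of \<open>1 / x / 2\<close>.
  Odd \<open>k\<close> contribute nothing.\<close>

lemma bessel_laplace_sums_at_0:
  assumes "\<nu> > 0" "x > 0"
  shows "(\<lambda>k. of_real (rGamma (2 * \<nu> + of_nat k + 1)) * ((deriv ^^ k) (bessel_laplace \<nu> x) 0 / fact k)) sums
         complex_of_real (1 / x * ((1 / x / 2) powr \<nu> * bessel_clifford \<nu> ((1 / x / 2)\<^sup>2)))"
proof -
  let ?H = "2 powr (2 * \<nu>) * Gamma (\<nu> + 1/2) / sqrt pi"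
  define f where "f = (\<lambda>k. rGamma (2 * \<nu> + of_nat k + 1) * (if even k
      then (x / 2) powr \<nu> * ?H * x powr (- 2 * \<nu> - 1) * (- (\<nu> + 1/2) gchoose (k div 2)) / x ^ k else 0))"
  define a where "a = (\<lambda>k. (-1) ^ k / fact k * rGamma (\<nu> + of_nat k + 1))"
  have "f (2 * j) = (x / 2) powr \<nu> * x powr (- 2 * \<nu> - 1) * (a j * ((1 / x / 2)\<^sup>2) ^ j)" for j
  proof -
    have "Gamma (2 * \<nu> + 2 * real j + 1) \<noteq> 0"
    proof -
      have "Gamma (2 * \<nu> + 2 * real j + 1) > 0"
        using assms by (intro Gamma_real_pos) auto
      then show ?thesis by (rule less_imp_neq[THEN not_sym])
    qed
    then have "a j = rGamma (2 * \<nu> + 2 * real j + 1) * (a j * Gamma (2 * \<nu> + 2 * real j + 1))"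
      by (simp add: rGamma_inverse_Gamma)
    also have "a j * Gamma (2 * \<nu> + 2 * real j + 1) = ?H * 4 ^ j * (- (\<nu> + 1/2) gchoose j)"
      unfolding a_def by (rule bessel_laplace_coeff[OF assms(1)])
    finally have a: "a j = rGamma (2 * \<nu> + 2 * real j + 1) * (?H * 4 ^ j * (- (\<nu> + 1/2) gchoose j))" .
    have pw: "((1 / x / 2)\<^sup>2) ^ j = 1 / (x ^ (2 * j) * 4 ^ j)"
      by (simp add: power_divide power_mult power_mult_distrib)
    have "R * (X * H * P * b / Y) = X * P * (R * (H * 4 ^ j * b) * (1 / (Y * 4 ^ j)))"
      for R X H P b Y :: real by simp
    then show ?thesis
      unfolding a pw by (simp add: f_def)
  qed
  moreover have "(\<lambda>j. (x / 2) powr \<nu> * x powr (- 2 * \<nu> - 1) * (a j * ((1 / x / 2)\<^sup>2) ^ j)) sums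
      ((x / 2) powr \<nu> * x powr (- 2 * \<nu> - 1) * bessel_clifford \<nu> ((1 / x / 2)\<^sup>2))"
    unfolding a_def using assms by (intro sums_mult bessel_clifford_sums) auto
  ultimately have "(\<lambda>j. f (2 * j)) sums
      ((x / 2) powr \<nu> * x powr (- 2 * \<nu> - 1) * bessel_clifford \<nu> ((1 / x / 2)\<^sup>2))"
    by simp
  then have "f sums ((x / 2) powr \<nu> * x powr (- 2 * \<nu> - 1) * bessel_clifford \<nu> ((1 / x / 2)\<^sup>2))"
    by (subst (asm) sums_mono_reindex) (auto simp: strict_mono_def f_def elim!: evenE)
  also have "(x / 2) powr \<nu> * x powr (- 2 * \<nu> - 1) * bessel_clifford \<nu> ((1 / x / 2)\<^sup>2) =
    1 / x * ((1 / x / 2) powr \<nu> * bessel_clifford \<nu> ((1 / x / 2)\<^sup>2))"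
  proof -
    have "x powr (- 2 * \<nu> - 1) = 1 / (x * (x powr \<nu> * x powr \<nu>))"
      using assms by (simp add: powr_diff powr_minus powr_add[symmetric] divide_inverse)
    then show ?thesis using assms
      by (simp add: powr_divide powr_mult)
  qed
  finally have "(\<lambda>k. complex_of_real (f k)) sums
      of_real (1 / x * ((1 / x / 2) powr \<nu> * bessel_clifford \<nu> ((1 / x / 2)\<^sup>2)))"
    by (rule sums_of_real)
  then show ?thesis
    unfolding bessel_laplace_taylor[OF assms(2)] f_def of_real_mult .
qed

subsection \<open>Removing the damping factor\<close>

text \<open>The limit of the damped integrals is computed twice: Abel summation gives the undamped
  integral, and Tannery's theorem, applied to the Taylor series of the Laplace transform, gives the
  closed form.\<close>

lemma bessel_product_integral:
  assumes "\<nu> > 0" "x > 0"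
  shows "((\<lambda>c. bessel_kernel \<nu> x c * bessel_clifford (2 * \<nu>) c) has_integral
           1 / x * ((1 / x / 2) powr \<nu> * bessel_clifford \<nu> ((1 / x / 2)\<^sup>2))) {0..}"
proof -
  let ?f = "\<lambda>c. bessel_kernel \<nu> x c * bessel_clifford (2 * \<nu>) c"
  let ?G = "bessel_laplace \<nu> x"
  obtain I where I: "(?f has_integral I) {0..}"
    and lim: "\<And>q. (\<And>n. q n > 0) \<Longrightarrow> q \<longlonglongrightarrow> 0 \<Longrightarrow>
       (\<lambda>n. integral {0..} (\<lambda>c. exp (- q n * c) * ?f c)) \<longlonglongrightarrow> I"
    using bessel_product_abel_integral[OF assms, folded bessel_kernel_def] by blast
  \<comment> \<open>A positive null sequence kept below \<open>x / 4\<close>, so that the closed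
    discs of radius \<open>x / 2\<close> about \<open>q n\<close> lie in the closed disc of radius
    \<open>3 * x / 4\<close> about 0, where one bound \<open>B\<close> holds for all
    \<open>n\<close>.\<close>
  define q where "q = (\<lambda>n::nat. x / 4 * inverse (real (Suc n)))"
  have q_pos: "q n > 0" for n using assms by (simp add: q_def)
  have q_le: "q n \<le> x / 4" for n using assms by (simp add: q_def field_simps)
  have "q \<longlonglongrightarrow> x / 4 * 0"
    unfolding q_def by (intro tendsto_mult tendsto_const LIMSEQ_inverse_real_of_nat)
  then have q_lim: "q \<longlonglongrightarrow> 0" by simp
  have hol: "?G holomorphic_on ball 0 x"
    using holomorphic_bessel_laplace[OF assms(2)] by (rule holomorphic_on_subset) auto
  have "compact (?G ` cball 0 (3 * x / 4))"
    using assms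
    by (intro compact_continuous_image continuous_on_subset[OF holomorphic_on_imp_continuous_on[OF hol]]) auto
  then obtain B where B: "\<And>p. norm p \<le> 3 * x / 4 \<Longrightarrow> norm (?G p) \<le> B"
    by (force dest!: compact_imp_bounded simp: bounded_iff)
  define t where "t = (\<lambda>k p. of_real (rGamma (2 * \<nu> + of_nat k + 1)) * ((deriv ^^ k) ?G p / fact k))"
  \<comment> \<open>The Cauchy inequality on radius \<open>x / 2\<close> gives
    \<open>B * (2 / x) ^ k\<close>, and \<open>rGamma_shift_le\<close> supplies the factorial: an
    exponential series independent of \<open>n\<close>.\<close>
  define M where "M = (\<lambda>k. rGamma (2 * \<nu> + 1) * B * ((2 / x) ^ k / fact k))"
  have t_le: "norm (t k (of_real (q n))) \<le> M k" for k n
  proof -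
    have sub: "cball (complex_of_real (q n)) (x / 2) \<subseteq> cball 0 (3 * x / 4)"
    proof
      fix p assume "p \<in> cball (complex_of_real (q n)) (x / 2)"
      then show "p \<in> cball 0 (3 * x / 4)"
        using norm_triangle_sub[of p "of_real (q n)"] q_pos[of n] q_le[of n]
        by (simp add: dist_norm norm_minus_commute)
    qed
    also have "\<dots> \<subseteq> ball 0 x" using assms by auto
    finally have sub': "cball (complex_of_real (q n)) (x / 2) \<subseteq> ball 0 x" .
    have "norm ((deriv ^^ k) ?G (of_real (q n))) \<le> fact k * B / (x / 2) ^ k"
    proof (rule Cauchy_inequality)
      show "?G holomorphic_on ball (of_real (q n)) (x / 2)"
        using hol by (rule holomorphic_on_subset) (use sub' ball_subset_cball in blast)
      show "continuous_on (cball (of_real (q n)) (x / 2)) ?G"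
        using holomorphic_on_imp_continuous_on[OF hol] sub' by (rule continuous_on_subset)
      fix p :: complex assume "norm (of_real (q n) - p) = x / 2"
      then have "p \<in> cball 0 (3 * x / 4)"
        by (intro subsetD[OF sub]) (simp add: dist_norm)
      then show "norm (?G p) \<le> B" by (intro B) simp
    qed (use assms in auto)
    then have d: "norm ((deriv ^^ k) ?G (of_real (q n)) / fact k) \<le> B * (2 / x) ^ k"
      by (simp add: norm_divide field_simps)
    have "norm (t k (of_real (q n))) = rGamma (2 * \<nu> + of_nat k + 1) * norm ((deriv ^^ k) ?G (of_real (q n)) / fact k)"
      unfolding t_def norm_mult norm_of_real
      using rGamma_shift_le(1)[of "2 * \<nu>" k] assms by simp
    also have "\<dots> \<le> (rGamma (2 * \<nu> + 1) / fact k) * (B * (2 / x) ^ k)"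
      using rGamma_shift_le[of "2 * \<nu>" k] rGamma_shift_le(1)[of "2 * \<nu>" 0] assms
      by (intro mult_mono d) auto
    finally show ?thesis by (simp add: M_def mult_ac)
  qed
  have M: "summable M"
    unfolding M_def using summable_exp[of "2 / x"] by (intro summable_mult) (simp add: field_simps)
  have t_lim: "(\<lambda>n. t k (of_real (q n))) \<longlonglongrightarrow> t k 0" for k
  proof -
    have "(deriv ^^ k) ?G holomorphic_on ball 0 x"
      using hol by (intro holomorphic_higher_deriv) auto
    then have "isCont ((deriv ^^ k) ?G) 0"
      using assms by (intro continuous_on_interior[OF holomorphic_on_imp_continuous_on]) auto
    moreover have "(\<lambda>n. complex_of_real (q n)) \<longlonglongrightarrow> 0"
      using tendsto_of_real[OF q_lim] by simp
    ultimately have "(\<lambda>n. (deriv ^^ k) ?G (of_real (q n))) \<longlonglongrightarrow> (deriv ^^ k) ?G 0"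
      by (rule isCont_tendsto_compose)
    then show ?thesis unfolding t_def by (intro tendsto_intros) auto
  qed
  have "(\<lambda>n. \<Sum>k. t k (of_real (q n))) \<longlonglongrightarrow> (\<Sum>k. t k 0)"
    using t_le by (intro tannerys_theorem[THEN conjunct2, THEN conjunct2, OF t_lim _ M] always_eventually) auto
  moreover have "(\<Sum>k. t k (of_real (q n))) = complex_of_real (integral {0..} (\<lambda>c. exp (- q n * c) * ?f c))" for n
    unfolding t_def by (rule sums_unique[symmetric, OF laplace_bessel_product_sums[OF assms q_pos]])
  moreover have "(\<Sum>k. t k 0) = complex_of_real (1 / x * ((1 / x / 2) powr \<nu> * bessel_clifford \<nu> ((1 / x / 2)\<^sup>2)))"
    unfolding t_def by (rule sums_unique[symmetric, OF bessel_laplace_sums_at_0[OF assms]])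
  ultimately have "(\<lambda>n. complex_of_real (integral {0..} (\<lambda>c. exp (- q n * c) * ?f c))) \<longlonglongrightarrow>
      of_real (1 / x * ((1 / x / 2) powr \<nu> * bessel_clifford \<nu> ((1 / x / 2)\<^sup>2)))"
    by (simp only:)
  then have "(\<lambda>n. integral {0..} (\<lambda>c. exp (- q n * c) * ?f c)) \<longlonglongrightarrow>
      1 / x * ((1 / x / 2) powr \<nu> * bessel_clifford \<nu> ((1 / x / 2)\<^sup>2))"
    by (simp only: tendsto_of_real_iff)
  with lim[OF q_pos q_lim] have "I = 1 / x * ((1 / x / 2) powr \<nu> * bessel_clifford \<nu> ((1 / x / 2)\<^sup>2))"
    by (rule LIMSEQ_unique)
  with I show ?thesis by simp
qed

section \<open>Return to the complex Bessel function\<close>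

lemma bessel_J_of_real:
  assumes "\<nu> \<ge> 0" "y \<ge> 0"
  shows "bessel_J \<nu> (of_real y) = of_real ((y / 2) powr \<nu> * bessel_clifford \<nu> ((y / 2)\<^sup>2))"
proof -
  \<comment> \<open>The endpoint \<open>c = 0\<close> of the integral lands on \<open>y = 0\<close>,
    which lies on the cut; there both the complex and the real power are 0.\<close>
  have "(complex_of_real y / 2) powr of_real \<nu> = of_real ((y / 2) powr \<nu>)"
    using powr_of_real[of "y / 2" \<nu>] assms by simp
  moreover have "(\<lambda>k. (-1) ^ k / fact k * rGamma (of_real \<nu> + of_nat k + 1) * (complex_of_real y / 2) ^ (2 * k))
    sums of_real (bessel_clifford \<nu> ((y / 2)\<^sup>2))"
  proof -
    have rG: "rGamma (complex_of_real \<nu> + of_nat k + 1) = of_real (rGamma (\<nu> + of_nat k + 1))" for k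
      using rGamma_complex_of_real[of "\<nu> + of_nat k + 1"] by simp
    show ?thesis
      using sums_of_real[OF bessel_clifford_sums[OF assms(1), of "(y / 2)\<^sup>2"], where ?'a = complex]
      by (simp add: rG power_mult)
  qed
  ultimately show ?thesis
    unfolding bessel_J_def by (simp add: sums_unique[symmetric])
qed

text \<open>A principal power times an entire function of \<open>(z / 2)^2\<close>; the cut comes
  from the power alone.\<close>

lemma holomorphic_bessel_J:
  assumes "\<nu> \<ge> 0"
  shows "bessel_J \<nu> holomorphic_on - \<real>\<^sub>\<le>\<^sub>0"
proof -
  define \<Phi> where "\<Phi> = (\<lambda>w::complex. \<Sum>k. (-1) ^ k / fact k * rGamma (of_real \<nu> + of_nat k + 1) * w ^ k)"
  have rG: "rGamma (complex_of_real \<nu> + of_nat k + 1) = of_real (rGamma (\<nu> + of_nat k + 1))" for k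
    using rGamma_complex_of_real[of "\<nu> + of_nat k + 1"] by simp
  have "\<Phi> holomorphic_on ball 0 r" for r
  proof (rule power_series_holomorphic)
    fix w :: complex
    show "(\<lambda>k. (-1) ^ k / fact k * rGamma (of_real \<nu> + of_nat k + 1) * (w - 0) ^ k) sums \<Phi> w"
      using summable_sums[OF summable_bessel_clifford[OF assms, of w]] by (simp add: \<Phi>_def rG)
  qed
  then have "\<Phi> field_differentiable at w" for w
    by (rule holomorphic_on_imp_differentiable_at[of _ "ball 0 (norm w + 1)"]) auto
  then have \<Phi>: "\<Phi> holomorphic_on UNIV"
    by (simp add: holomorphic_on_def)
  have "(\<lambda>z. (z / 2) powr of_real \<nu> * \<Phi> ((z / 2)\<^sup>2)) holomorphic_on - \<real>\<^sub>\<le>\<^sub>0"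
    by (intro holomorphic_intros holomorphic_on_compose_gen[OF _ \<Phi>, unfolded o_def])
       (auto simp: complex_nonpos_Reals_iff)
  then show ?thesis
    by (simp add: bessel_J_def[abs_def] \<Phi>_def power_mult)
qed

theorem theorem15:
  fixes \<nu> :: real and z :: complex
  assumes "\<nu> > 0" and "z \<notin> \<real>\<^sub>\<le>\<^sub>0"
  shows "has_continued_integral
           (\<lambda>w c. bessel_J \<nu> (complex_of_real c * w) * bessel_J (2 * \<nu>) (complex_of_real (2 * sqrt c)))
           (1 / z * bessel_J \<nu> (1 / z)) z"
  unfolding has_continued_integral_def
\<comment> \<open>The continuation is the claimed value as a function of \<open>w\<close>. It is
  holomorphic because the reciprocal maps the cut plane into itself.\<close>
proof (intro exI[of _ "\<lambda>w. 1 / w * bessel_J \<nu> (1 / w)"] conjI allI impI)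
  have inv: "1 / w \<in> - \<real>\<^sub>\<le>\<^sub>0" if "w \<in> - \<real>\<^sub>\<le>\<^sub>0" for w :: complex
    using that unfolding inverse_eq_divide[symmetric] by simp
  show "(\<lambda>w. 1 / w * bessel_J \<nu> (1 / w)) holomorphic_on - \<real>\<^sub>\<le>\<^sub>0"
  proof -
    have recip: "(\<lambda>w::complex. 1 / w) holomorphic_on - \<real>\<^sub>\<le>\<^sub>0"
      by (intro holomorphic_intros) auto
    have "bessel_J \<nu> \<circ> (\<lambda>w. 1 / w) holomorphic_on - \<real>\<^sub>\<le>\<^sub>0"
      using assms(1) inv
      by (intro holomorphic_on_compose_gen[OF recip holomorphic_bessel_J]) auto
    from holomorphic_on_mult[OF recip this] show ?thesis by (simp add: o_def)
  qed
next
  fix x :: real assume x: "x > 0"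
  have "bessel_J \<nu> (of_real c * of_real x) * bessel_J (2 * \<nu>) (of_real (2 * sqrt c)) =
      of_real (bessel_kernel \<nu> x c * bessel_clifford (2 * \<nu>) c)" if "c \<ge> 0" for c
  proof -
    have "bessel_J \<nu> (of_real c * of_real x) =
        of_real ((c * x / 2) powr \<nu> * bessel_clifford \<nu> ((c * x / 2)\<^sup>2))"
      using bessel_J_of_real[of \<nu> "c * x"] assms that x by simp
    moreover have "bessel_J (2 * \<nu>) (of_real (2 * sqrt c)) = of_real (c powr \<nu> * bessel_clifford (2 * \<nu>) c)"
      using bessel_J_of_real[of "2 * \<nu>" "2 * sqrt c"] assms that powr_powr[of c "1/2" "2 * \<nu>"]
      by (simp add: powr_half_sqrt)
    moreover have "(c * x / 2) powr \<nu> * c powr \<nu> = (x / 2) powr \<nu> * c powr (2 * \<nu>)"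
      using powr_mult[of c "x / 2" \<nu>] powr_add[of c \<nu> \<nu>] by simp
    then have "(c * x / 2) powr \<nu> * bessel_clifford \<nu> ((c * x / 2)\<^sup>2) * (c powr \<nu> * bessel_clifford (2 * \<nu>) c) =
        bessel_kernel \<nu> x c * bessel_clifford (2 * \<nu>) c"
      by (simp add: bessel_kernel_def)
    ultimately show ?thesis by (simp only: of_real_mult[symmetric])
  qed
  then have eq: "\<And>c. c \<in> {0..} \<Longrightarrow> of_real (bessel_kernel \<nu> x c * bessel_clifford (2 * \<nu>) c) =
      bessel_J \<nu> (of_real c * of_real x) * bessel_J (2 * \<nu>) (of_real (2 * sqrt c))"
    by simp
  have val: "1 / complex_of_real x * bessel_J \<nu> (1 / complex_of_real x) =
      of_real (1 / x * ((1 / x / 2) powr \<nu> * bessel_clifford \<nu> ((1 / x / 2)\<^sup>2)))"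
    unfolding of_real_mult[of "1 / x"] using bessel_J_of_real[of \<nu> "1 / x"] assms(1) x
    by (simp only: of_real_divide of_real_1 zero_le_divide_1_iff less_imp_le)
  show "((\<lambda>c. bessel_J \<nu> (of_real c * of_real x) * bessel_J (2 * \<nu>) (of_real (2 * sqrt c)))
      has_integral 1 / of_real x * bessel_J \<nu> (1 / of_real x)) {0..}"
    unfolding val
    by (rule has_integral_eq[OF eq has_integral_of_real[OF bessel_product_integral[OF assms(1) x]]])
qed simp

end
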